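(* Let $X$ be a real Banach space and let $A, B:X\rightrightarrows X^*$ be maximally monotone. Assume that $\bigcup_{\lambda>0}\lambda\left[\operatorname{dom} A-\operatorname{dom} B\right]$ is a closed subspace of $X$. Suppose that $A$ is ultramaximally monotone and that $B$ is of type (NI). Then $A+B$ is ultramaximally monotone.
   Context: $X$ is a real Banach space with dual $X^*$ and bidual $X^{**}$; $X$ is identified with its canonical image in $X^{**}$, and $\langle\cdot,\cdot\rangle$ denotes the duality pairing. A set-valued operator $A:X\rightrightarrows X^*$ assigns to each $x\in X$ a (possibly empty) set $Ax\subseteq X^*$; $\operatorname{gra}A=\{(x,x^* )\in X\times X^*\mid x^*\in Ax\}$ and $\operatorname{dom}A=\{x\in X\mid Ax\neq\varnothing\}$. The sum is $(A+B)x=Ax+Bx=\{a^*+b^*\mid a^*\in Ax,\ b^*\in Bx\}$. $A$ is monotone if $\langle x-y,x^*-y^*\rangle\ge 0$ for all $(x,x^* ),(y,y^* )\in\operatorname{gra}A$, and maximally monotone if it is monotone and has no proper monotone extension in $X\times X^*$ (in the sense of graph inclusion). A monotone $A$ is ultramaximally monotone if it is maximally monotone with respect to $X^{**}\times X^*$: whenever $(x^{**},x^* )\in X^{**}\times X^*$ satisfies $\langle x^{**}-a,x^*-a^*\rangle\ge 0$ for all $(a,a^* )\in\operatorname{gra}A$, then $x^{**}\in X$ and $(x^{**},x^* )\in\operatorname{gra}A$. A maximally monotone $A:X\rightrightarrows X^*$ is of type (NI) if $\inf_{(a,a^* )\in\operatorname{gra}A}\langle x^{**}-a,x^*-a^*\rangle\le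 0$ for all $(x^{**},x^* )\in X^{**}\times X^*$. For sets $C,D\subseteq X$, $C-D=\{c-d\mid c\in C,\ d\in D\}$. *)

theory Defs
  imports "HOL-Analysis.Analysis"
begin

type_synonym 'a dual = "'a \<Rightarrow>\<^sub>L real"
type_synonym 'a bidual = "('a \<Rightarrow>\<^sub>L real) \<Rightarrow>\<^sub>L real"
type_synonym 'a operator = "'a \<Rightarrow> ('a \<Rightarrow>\<^sub>L real) set"

text \<open>
  The identification of \<open>X\<close> with a subset of its bidual is written out as the canonical
  embedding. The pairing of \<open>x\<close> with \<open>f\<close> is \<open>blinfun_apply f x\<close>, and the pairing of an
  element \<open>xx\<close> of the bidual with \<open>f\<close> is \<open>blinfun_apply xx f\<close>.
\<close>

definition canonical_embedding :: "'a::real_normed_vector \<Rightarrow> 'a bidual" where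
  "canonical_embedding x = Blinfun (\<lambda>f. blinfun_apply f x)"

lemma blinfun_apply_canonical_embedding [simp]:
  "blinfun_apply (canonical_embedding x) f = blinfun_apply f x"
  unfolding canonical_embedding_def
  by (simp add: bounded_linear_Blinfun_apply blinfun.bounded_linear_left)

definition gra :: "'a::real_normed_vector operator \<Rightarrow> ('a \<times> 'a dual) set" where
  "gra A = {(x, f). f \<in> A x}"

definition op_dom :: "'a::real_normed_vector operator \<Rightarrow> 'a set" where
  "op_dom A = {x. A x \<noteq> {}}"

definition op_sum ::
  "'a::real_normed_vector operator \<Rightarrow> 'a operator \<Rightarrow> 'a operator" where
  "op_sum A B = (\<lambda>x. {f + g | f g. f \<in> A x \<and> g \<in> B x})"

definition set_diff :: "'a::real_normed_vector set \<Rightarrow> 'a set \<Rightarrow> 'a set" where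
  "set_diff C D = {c - d | c d. c \<in> C \<and> d \<in> D}"

definition monotone_op :: "'a::real_normed_vector operator \<Rightarrow> bool" where
  "monotone_op A \<longleftrightarrow>
     (\<forall>(x, f) \<in> gra A. \<forall>(y, g) \<in> gra A. blinfun_apply (f - g) (x - y) \<ge> 0)"

definition maximally_monotone :: "'a::real_normed_vector operator \<Rightarrow> bool" where
  "maximally_monotone A \<longleftrightarrow>
     monotone_op A \<and> (\<forall>B. monotone_op B \<and> gra A \<subseteq> gra B \<longrightarrow> gra B = gra A)"

definition ultramaximally_monotone :: "'a::real_normed_vector operator \<Rightarrow> bool" where
  "ultramaximally_monotone A \<longleftrightarrow>
     monotone_op A \<and>
     (\<forall>(xx :: 'a bidual) (f :: 'a dual).
        (\<forall>(a, g) \<in> gra A. blinfun_apply (xx - canonical_embedding a) (f - g) \<ge> 0) \<longrightarrow>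
        (\<exists>x. xx = canonical_embedding x \<and> (x, f) \<in> gra A))"

text \<open>
  The infimum is taken in the extended reals because it may be \<open>-\<infinity>\<close>; the real-valued
  \<open>Inf\<close> of a set that is unbounded below is unspecified.
\<close>

definition type_NI :: "'a::real_normed_vector operator \<Rightarrow> bool" where
  "type_NI A \<longleftrightarrow>
     maximally_monotone A \<and>
     (\<forall>(xx :: 'a bidual) (f :: 'a dual).
        (INF (a, g) \<in> gra A. ereal (blinfun_apply (xx - canonical_embedding a) (f - g))) \<le> 0)"

end

theory Submission
  imports Defs
begin

text \<open>
  Let \<open>C\<close> and \<open>D\<close> be the closed convex hulls of the graphs of the duality product over \<open>gra A\<close> and
  \<open>gra B\<close>, and let \<open>T\<close> be the closure of their partial sum (adding dual parts and heights over a
  common point of the space). The constraint qualification and an Attouch--Brezis argument show that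
  an upper bound for the conjugate of \<open>T\<close> at \<open>(xx, f)\<close> splits, for some \<open>g\<close>, into bounds for the
  conjugates of \<open>C\<close> at \<open>(xx, g)\<close> and of \<open>D\<close> at \<open>(xx, f - g)\<close>. If the bound is \<open>xx f\<close>, type (NI) of
  \<open>B\<close> and ultramaximality of \<open>A\<close> then force \<open>xx\<close> to come from a point \<open>x\<close> with \<open>(x, f)\<close> in the graph of
  \<open>A + B\<close>. Thus it suffices to bound the conjugate of \<open>T\<close> at every \<open>(xx, f)\<close> that is monotonically
  related to the graph of \<open>A + B\<close>.

  The same splitting shows that the conjugate of \<open>T\<close> majorises the duality product. By Fenchel duality
  and a Brondsted--Rockafellar iteration, for all \<open>t > 0\<close> and \<open>h\<close> the expression
  \<open>(w - h) a + t\<^sup>2 (norm a)\<^sup>2 / 2 + (norm (w - h))\<^sup>2 / (2 t\<^sup>2)\<close> is then arbitrarily small (or negative) at some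
  points of \<open>T\<close> lying exactly on the graph of the duality product, and these belong to the graph of
  \<open>A + B\<close>. Given \<open>((y, v), s)\<close> in \<open>T\<close>, take \<open>h = f + t (v - f)\<close> and let \<open>t\<close> tend to 0: the subgradient
  inequality at \<open>(a, w)\<close> becomes the required bound for \<open>((y, v), s)\<close>.
\<close>

section \<open>The Hahn--Banach theorem and Fenchel duality\<close>

definition sublinear :: "('a::real_vector \<Rightarrow> real) \<Rightarrow> bool" where
  "sublinear q \<longleftrightarrow> (\<forall>x y. q (x + y) \<le> q x + q y) \<and> (\<forall>t>0. \<forall>x. q (t *\<^sub>R x) = t * q x)"

lemma sublinear_add: "sublinear q \<Longrightarrow> q (x + y) \<le> q x + q y"
  and sublinear_scale: "sublinear q \<Longrightarrow> t > 0 \<Longrightarrow> q (t *\<^sub>R x) = t * q x"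
  by (auto simp: sublinear_def)

lemma sublinear_0: "sublinear q \<Longrightarrow> q 0 = 0"
  using sublinear_scale[of q 2 0] by simp

lemma sublinear_minus: "sublinear q \<Longrightarrow> - q (- x) \<le> q x"
  using sublinear_add[of q x "- x"] sublinear_0[of q] by simp

text \<open>Supplies the chain bounds for Zorn's lemma. Every member satisfies
  \<open>- q (- x) \<le> p x\<close>, so the infima are finite; comparability lets the smaller of
  two members serve at both points of the subadditivity inequality.\<close>

lemma sublinear_Inf_chain:
  fixes C :: "('a::real_vector \<Rightarrow> real) set"
  assumes "C \<noteq> {}" and sub: "\<And>p. p \<in> C \<Longrightarrow> sublinear p" and le: "\<And>p x. p \<in> C \<Longrightarrow> p x \<le> q x"
    and chain: "\<And>p p'. p \<in> C \<Longrightarrow> p' \<in> C \<Longrightarrow> p \<le> p' \<or> p' \<le> p"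
  shows "sublinear (\<lambda>x. INF p\<in>C. p x)" and "\<And>p x. p \<in> C \<Longrightarrow> (INF p\<in>C. p x) \<le> p x"
proof -
  have bdd: "bdd_below ((\<lambda>p. p x) ` C)" for x
  proof (rule bdd_belowI2)
    fix p assume "p \<in> C"
    then show "- q (- x) \<le> p x"
      using sublinear_minus[OF sub, of p x] le[of p "- x"] by linarith
  qed
  show low: "(INF p\<in>C. p x) \<le> p x" if "p \<in> C" for p x
    using bdd that by (rule cINF_lower)
  show "sublinear (\<lambda>x. INF p\<in>C. p x)"
    unfolding sublinear_def
  proof (intro conjI allI impI)
    fix x y
    have 1: "(INF p\<in>C. p (x + y)) \<le> p x + p' y" if "p \<in> C" "p' \<in> C" for p p'
      using chain[OF that]
    proof
      assume "p \<le> p'"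
      then have "p y \<le> p' y" by (simp add: le_fun_def)
      then show ?thesis using low[OF that(1), of "x + y"] sublinear_add[OF sub[OF that(1)], of x y] by linarith
    next
      assume "p' \<le> p"
      then have "p' x \<le> p x" by (simp add: le_fun_def)
      then show ?thesis using low[OF that(2), of "x + y"] sublinear_add[OF sub[OF that(2)], of x y] by linarith
    qed
    have "(INF p\<in>C. p (x + y)) - p x \<le> (INF p'\<in>C. p' y)" if "p \<in> C" for p
      using 1[OF that] by (intro cINF_greatest \<open>C \<noteq> {}\<close>) (simp add: algebra_simps)
    then have "(INF p\<in>C. p (x + y)) - (INF p'\<in>C. p' y) \<le> (INF p\<in>C. p x)"
      by (intro cINF_greatest \<open>C \<noteq> {}\<close>) (simp add: algebra_simps)
    then show "(INF p\<in>C. p (x + y)) \<le> (INF p\<in>C. p x) + (INF p\<in>C. p y)" by simp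
  next
    fix t :: real and x assume t: "t > 0"
    show "(INF p\<in>C. p (t *\<^sub>R x)) = t * (INF p\<in>C. p x)"
    proof (rule antisym)
      have "(INF p\<in>C. p (t *\<^sub>R x)) / t \<le> (INF p\<in>C. p x)"
      proof (intro cINF_greatest \<open>C \<noteq> {}\<close>)
        fix p assume "p \<in> C"
        then show "(INF p\<in>C. p (t *\<^sub>R x)) / t \<le> p x"
          using low[of p "t *\<^sub>R x"] sublinear_scale[OF sub t] t by (simp add: field_simps)
      qed
      then show "(INF p\<in>C. p (t *\<^sub>R x)) \<le> t * (INF p\<in>C. p x)"
        using t by (simp add: field_simps)
      show "t * (INF p\<in>C. p x) \<le> (INF p\<in>C. p (t *\<^sub>R x))"
      proof (intro cINF_greatest \<open>C \<noteq> {}\<close>)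
        fix p assume "p \<in> C"
        then show "t * (INF p\<in>C. p x) \<le> p (t *\<^sub>R x)"
          using low[of p x] sublinear_scale[OF sub t, of p] mult_left_mono[OF low[of p x], of t] t by simp
      qed
    qed
  qed
qed

text \<open>\<open>x \<mapsto> inf {p (x + t y) - t p y | t \<ge> 0}\<close> is sublinear and below \<open>p\<close>, hence equal to \<open>p\<close>;
  taking \<open>t = 1\<close> gives superadditivity.\<close>

lemma minimal_sublinear_linear:
  fixes p :: "'a::real_vector \<Rightarrow> real"
  assumes p: "sublinear p" and min: "\<And>r. sublinear r \<Longrightarrow> r \<le> p \<Longrightarrow> r = p"
  shows "linear p"
proof -
  have superadd: "p x + p y \<le> p (x + y)" for x y
  proof -
    define r where "r z = (INF t\<in>{0..}. p (z + t *\<^sub>R y) - t * p y)" for z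
    have bdd: "bdd_below ((\<lambda>t. p (z + t *\<^sub>R y) - t * p y) ` {0..})" for z
    proof (rule bdd_belowI2)
      fix t :: real assume t: "t \<in> {0..}"
      have "p (t *\<^sub>R y) = t * p y"
        using t sublinear_scale[OF p, of t y] sublinear_0[OF p] by (cases "t = 0") auto
      moreover have "p (t *\<^sub>R y) \<le> p (z + t *\<^sub>R y) + p (- z)"
        using sublinear_add[OF p, of "z + t *\<^sub>R y" "- z"] by (simp add: algebra_simps)
      ultimately show "- p (- z) \<le> p (z + t *\<^sub>R y) - t * p y" by simp
    qed
    have low: "r z \<le> p (z + t *\<^sub>R y) - t * p y" if "t \<ge> 0" for z t
      unfolding r_def using that by (intro cINF_lower bdd) auto
    have great: "m \<le> r z" if "\<And>t. t \<ge> 0 \<Longrightarrow> m \<le> p (z + t *\<^sub>R y) - t * p y" for m z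
      unfolding r_def using that by (intro cINF_greatest) auto
    have "sublinear r"
      unfolding sublinear_def
    proof (intro conjI allI impI)
      fix u v
      have 1: "r (u + v) \<le> (p (u + t *\<^sub>R y) - t * p y) + (p (v + s *\<^sub>R y) - s * p y)"
        if "t \<ge> 0" "s \<ge> 0" for s t
        using low[of "t + s" "u + v"] that sublinear_add[OF p, of "u + t *\<^sub>R y" "v + s *\<^sub>R y"]
        by (simp add: algebra_simps)
      have "r (u + v) - (p (u + t *\<^sub>R y) - t * p y) \<le> r v" if "t \<ge> 0" for t
        using 1[OF that] by (intro great) (simp add: algebra_simps)
      then have "r (u + v) - r v \<le> r u"
        by (intro great) (simp add: algebra_simps)
      then show "r (u + v) \<le> r u + r v" by simp
    next
      fix c :: real and z assume c: "c > 0"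
      \<comment> \<open>One inequality for all factors suffices: the converse is the same inequality
        for \<open>1 / c\<close> at \<open>c *\<^sub>R z\<close>.\<close>
      have ge: "d * r u \<le> r (d *\<^sub>R u)" if d: "d > 0" for d u
      proof (rule great)
        fix t :: real assume t: "t \<ge> 0"
        have "d * r u \<le> d * (p (u + (t / d) *\<^sub>R y) - (t / d) * p y)"
          using d t by (intro mult_left_mono low) auto
        also have "\<dots> = p (d *\<^sub>R (u + (t / d) *\<^sub>R y)) - t * p y"
          using d by (simp add: sublinear_scale[OF p d] right_diff_distrib)
        also have "d *\<^sub>R (u + (t / d) *\<^sub>R y) = d *\<^sub>R u + t *\<^sub>R y"
          using d by (simp add: scaleR_add_right)
        finally show "d * r u \<le> p (d *\<^sub>R u + t *\<^sub>R y) - t * p y" .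
      qed
      have "(1 / c) * r (c *\<^sub>R z) \<le> r z"
        using ge[of "1 / c" "c *\<^sub>R z"] c by simp
      then have "r (c *\<^sub>R z) \<le> c * r z" using c by (simp add: field_simps)
      then show "r (c *\<^sub>R z) = c * r z" using ge[OF c, of z] by simp
    qed
    moreover have "r \<le> p" using low[of 0] by (simp add: le_fun_def)
    ultimately have "r = p" by (rule min)
    then show ?thesis using low[of 1 x] by simp
  qed
  have add: "p (x + y) = p x + p y" for x y
    using superadd[of x y] sublinear_add[OF p, of x y] by simp
  have neg: "p (- x) = - p x" for x
    using add[of x "- x"] sublinear_0[OF p] by simp
  have "p (c *\<^sub>R x) = c * p x" for c x
  proof (cases "c > 0")
    case False
    then have "p ((- c) *\<^sub>R x) = (- c) * p x"
      using sublinear_scale[OF p, of "- c" x] sublinear_0[OF p] by (cases "c = 0") auto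
    then show ?thesis using neg[of "c *\<^sub>R x"] by simp
  qed (simp add: sublinear_scale[OF p])
  then show ?thesis using add by (intro linearI) auto
qed

theorem hahn_banach_sublinear:
  fixes q :: "'a::real_vector \<Rightarrow> real"
  assumes q: "sublinear q"
  shows "\<exists>p. linear p \<and> (\<forall>x. p x \<le> q x)"
proof -
  define S where "S = {p. sublinear p \<and> p \<le> q}"
  have "\<exists>m\<in>S. \<forall>p\<in>S. p \<le> m \<longrightarrow> p = m"
  \<comment> \<open>The order is reversed, so the maximal element of Zorn's lemma is a minimal
    sublinear functional, hence a linear one.\<close>
  proof (rule predicate_Zorn)
    show "partial_order_on S (relation_of (\<lambda>x y. y \<le> x) S)"
      by (rule partial_order_on_relation_ofI) auto
    fix C assume C: "C \<in> Chains (relation_of (\<lambda>x y. y \<le> x) S)"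
    show "\<exists>u\<in>S. \<forall>p\<in>C. u \<le> p"
    proof (cases "C = {}")
      case True then show ?thesis using q by (auto simp: S_def)
    next
      case False
      have CS: "p \<in> S" if "p \<in> C" for p using C that by (auto simp: Chains_def relation_of_def)
      have chain: "p \<le> p' \<or> p' \<le> p" if "p \<in> C" "p' \<in> C" for p p'
        using C that by (auto simp: Chains_def relation_of_def)
      have sub: "sublinear p" and le: "p x \<le> q x" if "p \<in> C" for p x
        using CS[OF that] by (auto simp: S_def le_fun_def)
      let ?u = "\<lambda>x. INF p\<in>C. p x"
      have inf: "sublinear ?u" "\<And>p x. p \<in> C \<Longrightarrow> ?u x \<le> p x"
        using sublinear_Inf_chain[of C q] False sub le chain by blast+
      obtain p where "p \<in> C" using False by blast
      then have "?u x \<le> q x" for x using inf(2)[of p x] le[of p x] by linarith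
      then have "?u \<in> S" using inf(1) by (auto simp: S_def le_fun_def)
      moreover have "\<forall>p\<in>C. ?u \<le> p" using inf(2) by (auto simp: le_fun_def)
      ultimately show ?thesis by blast
    qed
  qed
  then obtain m where m: "m \<in> S" and min: "\<And>p. p \<in> S \<Longrightarrow> p \<le> m \<Longrightarrow> p = m" by blast
  have "linear m"
  proof (rule minimal_sublinear_linear)
    show "sublinear m" using m by (simp add: S_def)
    fix r assume "sublinear r" "r \<le> m"
    moreover have "r \<le> q" using \<open>r \<le> m\<close> m by (auto simp: S_def intro: order_trans)
    ultimately show "r = m" using min by (simp add: S_def)
  qed
  then show ?thesis using m by (auto simp: S_def le_fun_def)
qed

text \<open>Here \<open>p\<close> is a linear functional below the sublinear hull of the value
  function sending \<open>x\<close> to the infimum of \<open>\<phi> e + N (G e + x)\<close> over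
  \<open>K\<close>, which is nonnegative at 0. Finiteness of \<open>N\<close> everywhere takes the
  place of an interior point condition.\<close>

theorem fenchel_separation:
  fixes \<phi> :: "'e::real_vector \<Rightarrow> real" and G :: "'e \<Rightarrow> 'z::real_vector"
  assumes \<phi>: "convex_on K \<phi>" and "linear G" and N: "convex_on UNIV N" and "K \<noteq> {}"
    and nonneg: "\<And>e. e \<in> K \<Longrightarrow> 0 \<le> \<phi> e + N (G e)"
  shows "\<exists>p. linear p \<and> (\<forall>e\<in>K. \<forall>z. p z - p (G e) \<le> \<phi> e + N z)"
proof -
  interpret G: linear G by fact
  \<comment> \<open>The factor \<open>t\<close> turns the value function into its perspective, which
    makes the infimum \<open>q\<close> positively homogeneous.\<close>
  define val where "val t e x = t * (\<phi> e + N (G e + (1 / t) *\<^sub>R x))" for t e x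
  define q where "q x = (INF (t, e)\<in>{0<..} \<times> K. val t e x)" for x
  obtain e0 where e0: "e0 \<in> K" using \<open>K \<noteq> {}\<close> by blast
  have conv: "convex K" using \<phi> by (simp add: convex_on_def)
  \<comment> \<open>Joint convexity of the perspective: the points are mixed with weights
    proportional to \<open>t\<close> and \<open>t'\<close>.\<close>
  have val_add: "\<exists>e''\<in>K. val (t + t') e'' (x + x') \<le> val t e x + val t' e' x'"
    if t: "t > 0" "t' > 0" and e: "e \<in> K" "e' \<in> K" for t t' e e' x x'
  proof (intro bexI)
    define s s' where "s = t / (t + t')" and "s' = t' / (t + t')"
    have s: "s \<ge> 0" "s' \<ge> 0" "s + s' = 1"
      using t by (auto simp: s_def s'_def simp flip: add_divide_distrib)
    let ?e = "s *\<^sub>R e + s' *\<^sub>R e'"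
    show "?e \<in> K" using convexD[OF conv e s] .
    have \<phi>le: "\<phi> ?e \<le> s * \<phi> e + s' * \<phi> e'"
      using \<phi> e s unfolding convex_on_def by auto
    have eq: "G ?e + (1 / (t + t')) *\<^sub>R (x + x') = s *\<^sub>R (G e + (1 / t) *\<^sub>R x) + s' *\<^sub>R (G e' + (1 / t') *\<^sub>R x')"
      using t by (simp add: G.add G.scale scaleR_add_right s_def s'_def)
    have "N (G ?e + (1 / (t + t')) *\<^sub>R (x + x')) \<le> s * N (G e + (1 / t) *\<^sub>R x) + s' * N (G e' + (1 / t') *\<^sub>R x')"
      unfolding eq using N s unfolding convex_on_def by auto
    then have "val (t + t') ?e (x + x') \<le>
      (t + t') * (s * (\<phi> e + N (G e + (1 / t) *\<^sub>R x)) + s' * (\<phi> e' + N (G e' + (1 / t') *\<^sub>R x')))"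
      unfolding val_def using \<phi>le t by (intro mult_left_mono) (auto simp: algebra_simps)
    also have "\<dots> = ((t + t') * s) * (\<phi> e + N (G e + (1 / t) *\<^sub>R x)) + ((t + t') * s') * (\<phi> e' + N (G e' + (1 / t') *\<^sub>R x'))"
      by (simp add: algebra_simps)
    also have "(t + t') * s = t" using t by (simp add: s_def)
    also have "(t + t') * s' = t'" using t by (simp add: s'_def)
    finally show "val (t + t') ?e (x + x') \<le> val t e x + val t' e' x'"
      by (simp add: val_def)
  qed
  have val0: "0 \<le> val t e 0" if "t > 0" "e \<in> K" for t e
    using nonneg[OF that(2)] that(1) by (simp add: val_def)
  \<comment> \<open>A fixed competitor at \<open>- x\<close>, together with nonnegativity at 0,
    bounds all values at \<open>x\<close> from below.\<close>
  have bdd: "bdd_below ((\<lambda>(t, e). val t e x) ` ({0<..} \<times> K))" for x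
  proof (rule bdd_belowI2)
    fix te :: "real \<times> 'e" assume "te \<in> {0<..} \<times> K"
    then obtain t e where te: "te = (t, e)" "t > 0" "e \<in> K" by auto
    obtain e'' where "e'' \<in> K" "val (t + 1) e'' (x + - x) \<le> val t e x + val 1 e0 (- x)"
      using val_add[of t 1 e e0 x "- x"] te e0 by auto
    then show "- val 1 e0 (- x) \<le> (case te of (t, e) \<Rightarrow> val t e x)"
      using val0[of "t + 1" e''] te by simp
  qed
  have low: "q x \<le> val t e x" if "t > 0" "e \<in> K" for t e x
    unfolding q_def using that cINF_lower[OF bdd, of "(t, e)" x] by auto
  have great: "m \<le> q x" if "\<And>t e. t > 0 \<Longrightarrow> e \<in> K \<Longrightarrow> m \<le> val t e x" for m x
    unfolding q_def using that e0 by (intro cINF_greatest) auto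
  have "sublinear q"
    unfolding sublinear_def
  proof (intro conjI allI impI)
    fix x y
    have 1: "q (x + y) \<le> val t e x + val t' e' y" if te: "t > 0" "t' > 0" "e \<in> K" "e' \<in> K" for t t' e e'
    proof -
      obtain e'' where "e'' \<in> K" "val (t + t') e'' (x + y) \<le> val t e x + val t' e' y"
        using val_add[OF te] by blast
      then show ?thesis using low[of "t + t'" e'' "x + y"] te by linarith
    qed
    have "q (x + y) - val t e x \<le> q y" if "t > 0" "e \<in> K" for t e
      using 1[OF that(1) _ that(2)] by (intro great) (simp add: algebra_simps)
    then have "q (x + y) - q y \<le> q x"
      by (intro great) (simp add: algebra_simps)
    then show "q (x + y) \<le> q x + q y" by simp
  next
    fix c :: real and x assume c: "c > 0"
    have ge: "d * q u \<le> q (d *\<^sub>R u)" if d: "d > 0" for d u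
    proof (rule great)
      fix t e assume t: "(t::real) > 0" "e \<in> K"
      have "d * q u \<le> d * val (t / d) e u"
        using d t by (intro mult_left_mono low) auto
      also have "\<dots> = val t e (d *\<^sub>R u)" using d by (simp add: val_def)
      finally show "d * q u \<le> val t e (d *\<^sub>R u)" .
    qed
    have "(1 / c) * q (c *\<^sub>R x) \<le> q x"
      using ge[of "1 / c" "c *\<^sub>R x"] c by simp
    then have "q (c *\<^sub>R x) \<le> c * q x" using c by (simp add: field_simps)
    then show "q (c *\<^sub>R x) = c * q x" using ge[OF c, of x] by simp
  qed
  then obtain p where p: "linear p" "\<And>x. p x \<le> q x"
    using hahn_banach_sublinear by blast
  have "p z - p (G e) \<le> \<phi> e + N z" if "e \<in> K" for e z
  proof -
    \<comment> \<open>At scale 1 the shift \<open>z - G e\<close> makes the argument of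
      \<open>N\<close> equal to \<open>z\<close>.\<close>
    have "p (z - G e) \<le> val 1 e (z - G e)"
      using p(2) low[of 1 e] that by (meson order_trans zero_less_one)
    then show ?thesis by (simp add: val_def linear_diff[OF p(1)])
  qed
  then show ?thesis using p(1) by blast
qed

section \<open>Attouch--Brezis duality\<close>

lemma bounded_linear_if_bounded_above_on_ball:
  fixes p :: "'a::real_normed_vector \<Rightarrow> real"
  assumes "linear p" and le: "\<And>z. norm z \<le> 1 \<Longrightarrow> p z \<le> C"
  shows "bounded_linear p"
proof -
  interpret p: linear p by fact
  have 1: "p z \<le> norm z * C" for z
  proof (cases "z = 0")
    case False
    then have "p ((1 / norm z) *\<^sub>R z) \<le> C" by (intro le) simp
    then show ?thesis using False by (simp add: p.scale field_simps)
  qed (simp add: p.zero)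
  have "\<bar>p z\<bar> \<le> norm z * C" for z
    using 1[of z] 1[of "- z"] by (simp add: p.neg abs_le_iff)
  then show ?thesis using p.add p.scale by (intro bounded_linear_intro) auto
qed

section \<open>An open mapping property for convex sets\<close>

lemma Baire_closed_cover:
  fixes L :: "'a::banach set"
  assumes "closed L" "L \<noteq> {}" and cover: "L \<subseteq> (\<Union>n::nat. closure (C n))"
  shows "\<exists>n. \<exists>x\<in>L. \<exists>r>0. ball x r \<inter> L \<subseteq> closure (C n)"
proof (rule ccontr)
  assume no: "\<not> ?thesis"
  let ?X = "top_of_set L"
  let ?G = "range (\<lambda>n. L \<inter> closure (C n))"
  have "?X interior_of \<Union>?G = {}"
  proof (rule Baire_category_alt)
    show "completely_metrizable_space ?X \<or> locally_compact_space ?X \<and> regular_space ?X"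
      using completely_metrizable_space_closedin[OF completely_metrizable_space_euclidean] \<open>closed L\<close>
      by auto
    show "countable ?G" by simp
    fix T assume "T \<in> ?G"
    then obtain n where T: "T = L \<inter> closure (C n)" by blast
    have "?X interior_of T = {}"
    proof (rule ccontr)
      assume "?X interior_of T \<noteq> {}"
      then obtain x U where xU: "openin ?X U" "x \<in> U" "U \<subseteq> T"
        by (auto simp: interior_of_def)
      then obtain r where "r > 0" "ball x r \<inter> L \<subseteq> U"
        unfolding openin_contains_ball by metis
      then show False using no xU T by blast
    qed
    then show "closedin ?X T \<and> ?X interior_of T = {}"
      using T by (auto simp: closedin_closed)
  qed
  moreover have "\<Union>?G = L" using cover by blast
  moreover have "?X interior_of L = L" by (simp add: interior_of_openin)
  ultimately show False using \<open>L \<noteq> {}\<close> by simp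
qed

lemma convex_Int_cball: "convex K \<Longrightarrow> convex {e \<in> K. norm (e :: 'a::real_normed_vector) \<le> R}"
  using convex_Int[of K "cball 0 R"] by (simp add: Int_def mem_cball_0 convex_cball)

text \<open>The iteration of the classical open mapping proof stays in \<open>K\<close>: its solution is a series
  with weights \<open>2\<^sup>-\<^sup>k\<close> of total mass one in a bounded closed convex set.\<close>

lemma convex_open_mapping:
  fixes G :: "'e::banach \<Rightarrow> 'x::banach"
  assumes G: "bounded_linear G" and K: "closed K" "convex K" and L: "closed L" "subspace L"
    and cone: "L = (\<Union>t\<in>{0<..}. (\<lambda>z. t *\<^sub>R z) ` G ` K)"
  shows "\<exists>\<delta>>0. \<exists>R. \<forall>d\<in>L. norm d < \<delta> \<longrightarrow> (\<exists>e\<in>K. norm e \<le> R \<and> G e = d)"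
proof -
  interpret G: bounded_linear G by fact
  define KK where "KK n = {e \<in> K. norm e \<le> n}" for n :: real
  have KK_convex: "convex (KK n)" for n unfolding KK_def by (rule convex_Int_cball) fact
  have KK_mono: "KK m \<subseteq> KK n" if "m \<le> n" for m n using that by (auto simp: KK_def)
  have GL: "G e \<in> L" if "e \<in> K" for e
  proof -
    have "1 *\<^sub>R G e \<in> (\<Union>t\<in>{0<..}. (\<lambda>z. t *\<^sub>R z) ` G ` K)"
      by (rule UN_I[of "1::real"]) (use that in \<open>auto simp del: scaleR_one\<close>)
    then show ?thesis unfolding scaleR_one cone[symmetric] .
  qed
  have "0 \<in> L" using L(2) by (rule subspace_0)
  then obtain t0 e0 where "t0 > 0" and e0: "e0 \<in> K" "0 = t0 *\<^sub>R G e0" unfolding cone by blast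
  then have e0: "e0 \<in> K" "G e0 = 0" by auto
  \<comment> \<open>Mixing \<open>e\<close> with the zero \<open>e0\<close> of \<open>G\<close> in
    \<open>K\<close> shrinks \<open>G e\<close> by the factor \<alpha>, which trades the real
    multiple \<open>t\<close> for an integer one.\<close>
  have absorb: "\<exists>n. d \<in> (\<lambda>z. real (Suc n) *\<^sub>R z) ` G ` KK (Suc n)" if "d \<in> L" for d
  proof -
    obtain t e where te: "t > 0" "e \<in> K" "d = t *\<^sub>R G e" using \<open>d \<in> L\<close> unfolding cone by blast
    obtain n :: nat where n: "max t (max (norm e) (norm e0)) \<le> real n"
      using real_arch_simple by blast
    let ?n = "real (Suc n)"
    define \<alpha> where "\<alpha> = t / ?n"
    have \<alpha>: "0 \<le> \<alpha>" "0 \<le> 1 - \<alpha>" "\<alpha> + (1 - \<alpha>) = 1" using te n by (auto simp: \<alpha>_def divide_le_eq_1)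
    have "e \<in> KK ?n" "e0 \<in> KK ?n" using n te e0 by (auto simp: KK_def)
    then have *: "\<alpha> *\<^sub>R e + (1 - \<alpha>) *\<^sub>R e0 \<in> KK ?n"
      using convexD[OF KK_convex] \<alpha> by blast
    have "?n * \<alpha> = t" by (simp add: \<alpha>_def)
    then have "d = ?n *\<^sub>R G (\<alpha> *\<^sub>R e + (1 - \<alpha>) *\<^sub>R e0)"
      unfolding te(3) G.add G.scaleR e0(2) scaleR_zero_right add_0_right scaleR_scaleR by simp
    then show ?thesis using * by blast
  qed
  define C where "C n = (\<lambda>z. real (Suc n) *\<^sub>R z) ` G ` KK (Suc n)" for n
  have "L \<subseteq> (\<Union>n. closure (C n))"
  proof
    fix d assume "d \<in> L"
    then obtain n where "d \<in> C n" using absorb unfolding C_def by metis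
    then show "d \<in> (\<Union>n. closure (C n))" using closure_subset[of "C n"] by blast
  qed
  moreover have "L \<noteq> {}" using \<open>0 \<in> L\<close> by blast
  ultimately obtain n :: nat and d0 r where d0: "d0 \<in> L" "r > 0" "ball d0 r \<inter> L \<subseteq> closure (C n)"
    using Baire_closed_cover[OF \<open>closed L\<close>] by metis
  \<comment> \<open>Reaching \<open>- d0\<close> as well moves the relative ball around
    \<open>d0\<close> to one around 0; division by \<open>a + b\<close> then turns the sum of the
    two multiples into a convex combination.\<close>
  have "- d0 \<in> L" using subspace_neg[OF L(2) d0(1)] .
  then obtain m where m: "- d0 \<in> (\<lambda>z. real (Suc m) *\<^sub>R z) ` G ` KK (Suc m)"
    using absorb by metis
  define a b where "a = real (Suc n)" and "b = real (Suc m)"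
  have ab: "a > 0" "b > 0" by (auto simp: a_def b_def)
  define N where "N = max (norm e0) (max a b)"
  define \<delta> where "\<delta> = r / (a + b)"
  have "\<delta> > 0" using d0 ab by (simp add: \<delta>_def)
  obtain e1 where e1: "e1 \<in> KK b" "- d0 = b *\<^sub>R G e1" using m unfolding b_def by blast
  have dense: "\<exists>e\<in>KK N. norm (d - G e) < \<epsilon>" if d: "d \<in> L" "norm d < \<delta>" and "\<epsilon> > 0" for d \<epsilon>
  proof -
    have "(a + b) *\<^sub>R d \<in> L" using d L(2) by (simp add: subspace_scale)
    then have "d0 + (a + b) *\<^sub>R d \<in> L" using d0(1) L(2) by (simp add: subspace_add)
    moreover have "d0 + (a + b) *\<^sub>R d \<in> ball d0 r"
    proof -
      have "dist d0 (d0 + (a + b) *\<^sub>R d) = (a + b) * norm d" using ab by (simp add: dist_norm)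
      also have "\<dots> < r" using d(2) ab by (simp add: \<delta>_def pos_less_divide_eq mult.commute)
      finally show ?thesis by simp
    qed
    ultimately have "d0 + (a + b) *\<^sub>R d \<in> closure ((\<lambda>z. a *\<^sub>R z) ` G ` KK a)"
      using d0(3) unfolding a_def C_def by (meson IntI subsetD)
    moreover have "(a + b) * \<epsilon> > 0" using ab \<open>\<epsilon> > 0\<close> by simp
    ultimately obtain y where y: "y \<in> (\<lambda>z. a *\<^sub>R z) ` G ` KK a"
      "dist y (d0 + (a + b) *\<^sub>R d) < (a + b) * \<epsilon>"
      unfolding closure_approachable by blast
    then obtain e2 where e2: "e2 \<in> KK a" "y = a *\<^sub>R G e2" by blast
    define e where "e = (a / (a + b)) *\<^sub>R e2 + (b / (a + b)) *\<^sub>R e1"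
    have "a \<le> N" "b \<le> N" by (auto simp: N_def)
    then have "e2 \<in> KK N" "e1 \<in> KK N" using e1(1) e2(1) KK_mono by blast+
    then have "e \<in> KK N" unfolding e_def using ab
      by (intro convexD[OF KK_convex]) (auto simp flip: add_divide_distrib)
    moreover have "norm (d - G e) < \<epsilon>"
    proof -
      have Ge: "(a + b) *\<^sub>R G e = y - d0"
        using e1(2) e2(2) ab by (simp add: e_def G.add G.scaleR scaleR_add_right)
      have "(a + b) * norm (d - G e) = norm ((a + b) *\<^sub>R (d - G e))"
        using ab by simp
      also have "(a + b) *\<^sub>R (d - G e) = (d0 + (a + b) *\<^sub>R d) - y"
        unfolding scaleR_diff_right Ge by simp
      also have "norm \<dots> < (a + b) * \<epsilon>" using y(2) by (simp add: dist_norm norm_minus_commute)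
      finally show ?thesis using ab by (simp add: mult_less_cancel_left)
    qed
    ultimately show ?thesis by blast
  qed
  have "\<exists>e\<in>K. norm e \<le> N \<and> G e = d" if d: "d \<in> L" "norm d < \<delta> / 2" for d
  proof -
    define ch where "ch u = (SOME e. e \<in> KK N \<and> norm (u - G e) < \<delta> / 2)" for u
    have ch: "ch u \<in> KK N" "norm (u - G (ch u)) < \<delta> / 2" if "u \<in> L" "norm u < \<delta>" for u
    proof -
      have "\<exists>e. e \<in> KK N \<and> norm (u - G e) < \<delta> / 2"
        using dense[OF that, of "\<delta> / 2"] \<open>\<delta> > 0\<close> by auto
      then have "ch u \<in> KK N \<and> norm (u - G (ch u)) < \<delta> / 2"
        unfolding ch_def by (rule someI_ex)
      then show "ch u \<in> KK N" "norm (u - G (ch u)) < \<delta> / 2" by auto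
    qed
    \<comment> \<open>\<open>D k\<close> is the residual \<open>d - G (s k)\<close> magnified by
      \<open>2 ^ Suc k\<close>. Starting from \<open>2 *\<^sub>R d\<close> gives the weights 1/2,
      1/4, ... of total mass one.\<close>
    define D where "D = rec_nat (2 *\<^sub>R d) (\<lambda>_ u. 2 *\<^sub>R (u - G (ch u)))"
    have D0: "D 0 = 2 *\<^sub>R d" and DSuc: "D (Suc k) = 2 *\<^sub>R (D k - G (ch (D k)))" for k
      by (auto simp: D_def)
    have D: "D k \<in> L \<and> norm (D k) < \<delta>" for k
    proof (induction k)
      case 0
      then show ?case using d L(2) by (simp add: D0 subspace_scale)
    next
      case (Suc k)
      then have c: "ch (D k) \<in> K" "norm (D k - G (ch (D k))) < \<delta> / 2"
        using ch[of "D k"] by (auto simp: KK_def)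
      then have "D k - G (ch (D k)) \<in> L" using Suc GL subspace_diff[OF L(2)] by blast
      then show ?case using c(2) L(2) by (simp add: DSuc subspace_scale)
    qed
    define s where "s k = (\<Sum>j<k. (1 / 2) ^ Suc j *\<^sub>R ch (D j))" for k
    have chN: "ch (D k) \<in> KK N" for k using D ch by blast
    \<comment> \<open>The missing mass \<open>(1 / 2) ^ k\<close> is put on an arbitrary point of
      \<open>KK N\<close>, which completes the partial sum to a convex combination.\<close>
    have sK: "s k + (1 / 2) ^ k *\<^sub>R e \<in> KK N" if "e \<in> KK N" for k e
      using that
    proof (induction k arbitrary: e)
      case (Suc k)
      have "(1 / 2 :: real) *\<^sub>R ch (D k) + (1 / 2 :: real) *\<^sub>R e \<in> KK N"
        using Suc.prems chN by (intro convexD[OF KK_convex]) auto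
      from Suc.IH[OF this] show ?case
        by (simp add: s_def scaleR_add_right algebra_simps)
    qed (simp add: s_def)
    have Gs: "d - G (s k) = (1 / 2) ^ Suc k *\<^sub>R D k" for k
    proof (induction k)
      case (Suc k)
      have "s (Suc k) = s k + (1 / 2) ^ Suc k *\<^sub>R ch (D k)" by (simp add: s_def)
      then have "d - G (s (Suc k)) = (d - G (s k)) - (1 / 2) ^ Suc k *\<^sub>R G (ch (D k))"
        by (simp only: G.add G.scaleR diff_diff_eq)
      also have "\<dots> = (1 / 2) ^ Suc k *\<^sub>R (D k - G (ch (D k)))"
        unfolding Suc by (simp only: scaleR_diff_right)
      also have "\<dots> = (1 / 2) ^ Suc (Suc k) *\<^sub>R D (Suc k)"
        unfolding DSuc scaleR_scaleR by simp
      finally show ?case .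
    qed (simp add: s_def D0 G.zero)
    have half: "(\<lambda>k. (1 / 2 :: real) ^ k) \<longlonglongrightarrow> 0" by (intro LIMSEQ_power_zero) auto
    have "summable (\<lambda>j. (1 / 2) ^ Suc j *\<^sub>R ch (D j))"
    proof (rule summable_comparison_test)
      show "summable (\<lambda>j. (1 / 2 :: real) ^ j * N)"
        by (intro summable_mult2 summable_geometric) auto
      have "norm (ch (D j)) \<le> N * 2" for j
        using chN[of j] norm_ge_zero[of "ch (D j)"] unfolding KK_def mem_Collect_eq by linarith
      then show "\<exists>M. \<forall>j\<ge>M. norm ((1 / 2) ^ Suc j *\<^sub>R ch (D j)) \<le> (1 / 2) ^ j * N"
        by simp
    qed
    then obtain e where lim: "s \<longlonglongrightarrow> e"
      unfolding s_def using summable_LIMSEQ by blast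
    have "closed (KK N)"
      using closed_Int[OF \<open>closed K\<close> closed_cball[of 0 N]] by (simp add: KK_def Int_def)
    moreover have "e0 \<in> KK N" using e0 by (auto simp: KK_def N_def)
    moreover have "(\<lambda>k. s k + (1 / 2) ^ k *\<^sub>R e0) \<longlonglongrightarrow> e + 0 *\<^sub>R e0"
      by (intro tendsto_intros lim half)
    ultimately have "e + 0 *\<^sub>R e0 \<in> KK N"
      using sK closed_sequentially[of "KK N" "\<lambda>k. s k + (1 / 2) ^ k *\<^sub>R e0"] by blast
    then have "e \<in> KK N" by simp
    moreover have "G e = d"
    proof -
      have "(\<lambda>k. d - G (s k)) \<longlonglongrightarrow> 0"
      proof (rule Lim_null_comparison)
        have "norm (d - G (s k)) \<le> (1 / 2) ^ k * \<delta>" for k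
        proof -
          have "norm (d - G (s k)) = (1 / 2) ^ Suc k * norm (D k)" unfolding Gs by simp
          also have "\<dots> \<le> (1 / 2) ^ k * \<delta>"
            using D[of k] by (intro mult_mono) auto
          finally show ?thesis .
        qed
        then show "\<forall>\<^sub>F k in sequentially. norm (d - G (s k)) \<le> (1 / 2) ^ k * \<delta>" by simp
        show "(\<lambda>k. (1 / 2) ^ k * \<delta>) \<longlonglongrightarrow> 0" using tendsto_mult_left_zero[OF half] .
      qed
      moreover have "(\<lambda>k. d - G (s k)) \<longlonglongrightarrow> d - G e"
        by (intro tendsto_intros G.tendsto lim)
      ultimately have "d - G e = 0" using LIMSEQ_unique by blast
      then show ?thesis by simp
    qed
    ultimately show ?thesis by (auto simp: KK_def)
  qed
  then show ?thesis using \<open>\<delta> > 0\<close> by (intro exI[of _ "\<delta> / 2"]) auto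
qed

text \<open>The open mapping property makes a multiple of \<open>norm (G e)\<close> an exact penalty
  for the constraint \<open>G e = 0\<close>. Fenchel separation against the penalty yields the
  multiplier, continuous because the penalty is bounded on the unit ball.\<close>

theorem attouch_brezis_multiplier:
  fixes G :: "'e::banach \<Rightarrow> 'x::banach" and \<phi> :: "'e \<Rightarrow> real"
  assumes G: "bounded_linear G" and K: "closed K" "convex K" and L: "closed L" "subspace L"
    and cone: "L = (\<Union>t\<in>{0<..}. (\<lambda>z. t *\<^sub>R z) ` G ` K)"
    and \<phi>: "bounded_linear \<phi>" and nonneg: "\<And>e. e \<in> K \<Longrightarrow> G e = 0 \<Longrightarrow> 0 \<le> \<phi> e + c"
  shows "\<exists>p. bounded_linear p \<and> (\<forall>e\<in>K. p (G e) \<le> \<phi> e + c)"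
proof -
  interpret G: bounded_linear G by fact
  interpret \<phi>: bounded_linear \<phi> by fact
  obtain \<delta> R where \<delta>: "\<delta> > 0"
    and ball: "\<And>d. d \<in> L \<Longrightarrow> norm d < \<delta> \<Longrightarrow> \<exists>e\<in>K. norm e \<le> R \<and> G e = d"
    using convex_open_mapping[OF G K L cone] by blast
  obtain B where B: "B \<ge> 0" "\<And>e. norm (\<phi> e) \<le> norm e * B" using \<phi>.nonneg_bounded by blast
  define M where "M = \<bar>R\<bar> * B + \<bar>c\<bar>"
  have M: "M \<ge> 0" "\<phi> e + c \<le> M" if "norm e \<le> R" for e
  proof -
    show "M \<ge> 0" using B by (simp add: M_def)
    have "norm e * B \<le> \<bar>R\<bar> * B" using that B by (intro mult_right_mono) auto
    then show "\<phi> e + c \<le> M" using B(2)[of e] by (simp add: M_def)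
  qed
  have GL: "G e \<in> L" if "e \<in> K" for e
  proof -
    have "1 *\<^sub>R G e \<in> (\<Union>t\<in>{0<..}. (\<lambda>z. t *\<^sub>R z) ` G ` K)"
      by (rule UN_I[of "1::real"]) (use that in \<open>auto simp del: scaleR_one\<close>)
    then show ?thesis unfolding scaleR_one cone[symmetric] .
  qed
  \<comment> \<open>\<open>M\<close> bounds the objective at points of norm at most
    \<open>R\<close>, and \<open>\<delta> / 2\<close> is the norm of the correction \<open>d\<close>
    below; \<kappa> is their ratio.\<close>
  define \<kappa> where "\<kappa> = 2 * M / \<delta>"
  have "0 \<in> L" using L(2) by (rule subspace_0)
  then obtain e0 where e0: "e0 \<in> K" "norm e0 \<le> R" "G e0 = 0" using ball[of 0] \<delta> by auto
  have "\<kappa> \<ge> 0" using M[OF e0(2)] \<delta> by (simp add: \<kappa>_def)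
  have below: "0 \<le> (\<phi> e + c) + \<kappa> * norm (G e)" if e: "e \<in> K" for e
  proof (cases "G e = 0")
    case False
    \<comment> \<open>\<open>d\<close> points against \<open>G e\<close>, so a convex combination of
      \<open>e\<close> and a bounded preimage \<open>e'\<close> of \<open>d\<close> is
      feasible.\<close>
    define d where "d = (- (\<delta> / 2) / norm (G e)) *\<^sub>R G e"
    have "d \<in> L" unfolding d_def using GL[OF e] L(2) by (intro subspace_scale)
    moreover have "norm d < \<delta>" using \<delta> False by (simp add: d_def)
    ultimately obtain e' where e': "e' \<in> K" "norm e' \<le> R" "G e' = d" using ball by blast
    define u v where "u = \<delta> / 2" and "v = norm (G e)"
    have uv: "u > 0" "v > 0" using \<delta> False by (auto simp: u_def v_def)
    let ?e = "(u / (u + v)) *\<^sub>R e + (v / (u + v)) *\<^sub>R e'"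
    have "?e \<in> K" using e e' uv
      by (intro convexD[OF K(2)]) (auto simp flip: add_divide_distrib)
    moreover have "G ?e = 0"
      using uv by (simp add: G.add G.scaleR e'(3) d_def flip: u_def v_def)
    ultimately have "0 \<le> \<phi> ?e + c" by (rule nonneg)
    also have "\<phi> ?e = (u * \<phi> e + v * \<phi> e') / (u + v)"
      by (simp add: \<phi>.add \<phi>.scaleR add_divide_distrib)
    finally have "0 \<le> (u * \<phi> e + v * \<phi> e') + c * (u + v)"
      using uv by (simp add: field_simps)
    also have "\<dots> = u * (\<phi> e + c) + v * (\<phi> e' + c)" by (simp add: algebra_simps)
    also have "\<dots> \<le> u * (\<phi> e + c) + v * M" using M(2)[OF e'(2)] uv by simp
    finally have "0 \<le> (\<phi> e + c) + v * M / u" using uv by (simp add: field_simps)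
    then show ?thesis by (simp add: \<kappa>_def u_def v_def field_simps)
  qed (use nonneg[OF e] in simp)
  have "convex_on K (\<lambda>e. \<phi> e + c)"
    unfolding convex_on_def
  proof (intro conjI K(2) ballI allI impI)
    fix x y and u v :: real assume "0 \<le> u" "0 \<le> v" and uv: "u + v = 1"
    have "c = (u + v) * c" using uv by simp
    also have "\<dots> = u * c + v * c" by (simp add: algebra_simps)
    finally show "\<phi> (u *\<^sub>R x + v *\<^sub>R y) + c \<le> u * (\<phi> x + c) + v * (\<phi> y + c)"
      unfolding \<phi>.add \<phi>.scaleR by (simp add: algebra_simps)
  qed
  moreover have "convex_on UNIV (\<lambda>z :: 'x. \<kappa> * norm z)"
    using convex_on_cmul[OF \<open>\<kappa> \<ge> 0\<close> convex_on_dist[of UNIV 0]] by (simp add: dist_norm)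
  ultimately obtain p where p: "linear p"
    and ple: "\<And>e z. e \<in> K \<Longrightarrow> p z - p (G e) \<le> (\<phi> e + c) + \<kappa> * norm z"
    using fenchel_separation[of K "\<lambda>e. \<phi> e + c" G "\<lambda>z. \<kappa> * norm z", OF _ G.linear_axioms] below e0(1)
    by blast
  have "bounded_linear p"
  proof (rule bounded_linear_if_bounded_above_on_ball[OF p])
    fix z :: 'x assume "norm z \<le> 1"
    then have "\<kappa> * norm z \<le> \<kappa> * 1" using \<open>\<kappa> \<ge> 0\<close> by (rule mult_left_mono)
    then show "p z \<le> \<phi> e0 + c + p (G e0) + \<kappa>" using ple[OF e0(1), of z] by linarith
  qed
  then have "bounded_linear (\<lambda>x. - p x)" by (rule bounded_linear_minus)
  moreover have "- p (G e) \<le> \<phi> e + c" if "e \<in> K" for e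
    using ple[OF that, of 0] linear_0[OF p] by simp
  ultimately show ?thesis by blast
qed

section \<open>Convex representatives of monotone operators\<close>

definition pairing :: "'a::real_normed_vector \<times> 'a dual \<Rightarrow> real" where
  "pairing z = blinfun_apply (snd z) (fst z)"

lemma pairing_Pair [simp]: "pairing (a, w) = blinfun_apply w a"
  by (simp add: pairing_def)

lemma tendsto_pairing [tendsto_intros]:
  "(z \<longlongrightarrow> l) F \<Longrightarrow> ((\<lambda>n. pairing (z n)) \<longlongrightarrow> pairing l) F"
  unfolding pairing_def by (intro blinfun.tendsto tendsto_intros)

lemma abs_pairing_le: "\<bar>pairing z\<bar> \<le> (norm z)\<^sup>2 / 2"
proof -
  have "\<bar>pairing z\<bar> \<le> norm (snd z) * norm (fst z)"
    using norm_blinfun[of "snd z" "fst z"] by (simp add: pairing_def)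
  also have "\<dots> \<le> ((norm (fst z))\<^sup>2 + (norm (snd z))\<^sup>2) / 2"
    using sum_squares_bound[of "norm (fst z)" "norm (snd z)"] by (simp add: mult_ac)
  also have "\<dots> = (norm z)\<^sup>2 / 2"
    by (cases z) (simp add: norm_Pair)
  finally show ?thesis .
qed

lemma abs_pairing_diff_le: "\<bar>pairing z' - pairing z\<bar> \<le> norm (z' - z) * (norm z + norm z')"
proof -
  obtain a w where z: "z = (a, w)" by (cases z)
  obtain a' w' where z': "z' = (a', w')" by (cases z')
  have "pairing z' - pairing z = w' (a' - a) + (w' - w) a"
    by (simp add: z z' blinfun.diff_left blinfun.diff_right)
  moreover have "\<bar>w' (a' - a)\<bar> \<le> norm z' * norm (z' - z)"
    using norm_blinfun[of w' "a' - a"]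
      mult_mono[OF norm_snd_le[of w' a'] norm_fst_le[of "a' - a" "w' - w"]] by (simp add: z z')
  moreover have "\<bar>(w' - w) a\<bar> \<le> norm (z' - z) * norm z"
    using norm_blinfun[of "w' - w" a]
      mult_mono[OF norm_snd_le[of "w' - w" "a' - a"] norm_fst_le[of a w]] by (simp add: z z')
  ultimately show ?thesis by (simp add: algebra_simps)
qed

text \<open>\<open>T\<close> plays the role of the epigraph of a convex representative of an operator: the
  representative and its conjugate both majorise the duality product.\<close>

definition strongly_representing :: "(('a::real_normed_vector \<times> 'a dual) \<times> real) set \<Rightarrow> bool" where
  "strongly_representing T \<longleftrightarrow> closed T \<and> convex T \<and> T \<noteq> {} \<and>
     (\<forall>(z, r)\<in>T. pairing z \<le> r) \<and>
     (\<forall>(xx :: 'a bidual) (f :: 'a dual). \<forall>\<epsilon>>0. \<exists>((a, w), r)\<in>T. blinfun_apply xx f - \<epsilon> < blinfun_apply xx w + blinfun_apply f a - r)"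

text \<open>Scaling the two factors reciprocally and translating changes the height by exactly the
  amount by which it changes the duality product.\<close>

definition recentre :: "real \<Rightarrow> 'a::real_normed_vector \<Rightarrow> 'a dual \<Rightarrow> ('a \<times> 'a dual) \<times> real
    \<Rightarrow> ('a \<times> 'a dual) \<times> real" where
  "recentre \<mu> x f = (\<lambda>((a, w), r). ((\<mu> *\<^sub>R (a - x), (1 / \<mu>) *\<^sub>R (w - f)), r - blinfun_apply f a - blinfun_apply w x + blinfun_apply f x))"

lemma strongly_representing_pairing_le: "strongly_representing T \<Longrightarrow> (z, r) \<in> T \<Longrightarrow> pairing z \<le> r"
  by (auto simp: strongly_representing_def)

lemma strongly_representing_conjugate:
  fixes xx :: "'a::real_normed_vector bidual" and f :: "'a dual"
  assumes T: "strongly_representing T" and "\<epsilon> > 0"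
  obtains a w r where "((a, w), r) \<in> T" "xx f - \<epsilon> < xx w + f a - r"
proof -
  have "\<exists>((a, w), r)\<in>T. blinfun_apply xx f - \<epsilon> < blinfun_apply xx w + blinfun_apply f a - r"
    using assms by (simp add: strongly_representing_def)
  then show thesis using that by auto
qed

text \<open>Recentring is an affine bijection with inverse \<open>inv\<close>: closedness is
  obtained from a preimage, convexity from an affine image.\<close>

lemma strongly_representing_recentre:
  assumes T: "strongly_representing T" and \<mu>: "\<mu> > 0"
  shows "strongly_representing (recentre \<mu> x f ` T)"
  unfolding strongly_representing_def
proof (intro conjI)
  define inv where "inv = (\<lambda>((a, w), r). (((1 / \<mu>) *\<^sub>R a + x, \<mu> *\<^sub>R w + f), r + (blinfun_apply f ((1 / \<mu>) *\<^sub>R a) + blinfun_apply (\<mu> *\<^sub>R w) x + blinfun_apply f x)))"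
  have inv1: "inv (recentre \<mu> x f e) = e" for e
  proof -
    obtain a w r where e: "e = ((a, w), r)" by (metis surj_pair)
    show ?thesis unfolding e using \<mu> by (simp add: inv_def recentre_def blinfun.diff_left blinfun.diff_right)
  qed
  have inv2: "recentre \<mu> x f (inv e) = e" for e
  proof -
    obtain a w r where e: "e = ((a, w), r)" by (metis surj_pair)
    show ?thesis unfolding e using \<mu> by (simp add: inv_def recentre_def blinfun.add_left blinfun.add_right)
  qed
  have "recentre \<mu> x f ` T = inv -` T"
  proof (intro equalityI subsetI)
    fix e assume "e \<in> inv -` T"
    then have "inv e \<in> T" by simp
    then have "recentre \<mu> x f (inv e) \<in> recentre \<mu> x f ` T" by (rule imageI)
    then show "e \<in> recentre \<mu> x f ` T" unfolding inv2 .
  next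
    fix e assume "e \<in> recentre \<mu> x f ` T"
    then obtain e' where "e' \<in> T" "e = recentre \<mu> x f e'" by blast
    then show "e \<in> inv -` T" by (simp add: inv1)
  qed
  moreover have "closed (inv -` T)"
  proof (rule continuous_closed_vimage)
    show "closed T" using T by (simp add: strongly_representing_def)
    show "continuous (at e) inv" for e :: "('a \<times> 'a dual) \<times> real"
      unfolding inv_def split_beta by (intro continuous_intros)
  qed
  ultimately show "closed (recentre \<mu> x f ` T)" by simp
  let ?lin = "\<lambda>e. ((\<mu> *\<^sub>R fst (fst e), (1 / \<mu>) *\<^sub>R snd (fst e)), snd e - blinfun_apply f (fst (fst e)) - blinfun_apply (snd (fst e)) x)"
  have "linear ?lin"
    by (rule linearI) (auto simp: blinfun.bilinear_simps algebra_simps)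
  then have "convex (?lin ` T)"
    using T by (intro convex_linear_image) (auto simp: strongly_representing_def)
  then have "convex ((\<lambda>e. ((- (\<mu> *\<^sub>R x), - ((1 / \<mu>) *\<^sub>R f)), f x) + e) ` ?lin ` T)"
    by (rule convex_translation)
  also have "(\<lambda>e. ((- (\<mu> *\<^sub>R x), - ((1 / \<mu>) *\<^sub>R f)), f x) + e) ` ?lin ` T = recentre \<mu> x f ` T"
    unfolding image_image
    by (intro image_cong) (auto simp: recentre_def blinfun.bilinear_simps algebra_simps)
  finally show "convex (recentre \<mu> x f ` T)" .
  show "recentre \<mu> x f ` T \<noteq> {}" using T by (simp add: strongly_representing_def)
  have "pairing z \<le> r" if e: "((a, w), s) \<in> T" "(z, r) = recentre \<mu> x f ((a, w), s)" for z r a w s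
  proof -
    have "w a \<le> s" using strongly_representing_pairing_le[OF T e(1)] by simp
    moreover have z: "z = (\<mu> *\<^sub>R (a - x), (1 / \<mu>) *\<^sub>R (w - f))" and r: "r = s - f a - w x + f x"
      using e(2) by (auto simp: recentre_def)
    have "pairing z = (w - f) (a - x)"
      using \<mu> by (simp add: z blinfun.scaleR_left blinfun.scaleR_right)
    ultimately show ?thesis by (simp add: r blinfun.diff_left blinfun.diff_right)
  qed
  then show "\<forall>(z, r)\<in>recentre \<mu> x f ` T. pairing z \<le> r" by fastforce
  show "\<forall>(xx :: 'a bidual) (g :: 'a dual). \<forall>\<epsilon>>0. \<exists>((a, w), r)\<in>recentre \<mu> x f ` T. blinfun_apply xx g - \<epsilon> < blinfun_apply xx w + blinfun_apply g a - r"
  proof (intro allI impI)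
    fix xx :: "'a bidual" and g :: "'a dual" and \<epsilon> :: real assume "\<epsilon> > 0"
    \<comment> \<open>The preimage of \<open>(xx, g)\<close> under the recentring extended to the
      bidual.\<close>
    let ?xx = "(1 / \<mu>) *\<^sub>R xx + canonical_embedding x" and ?g = "\<mu> *\<^sub>R g + f"
    obtain a w r where e: "((a, w), r) \<in> T" "?xx ?g - \<epsilon> < ?xx w + ?g a - r"
      by (rule strongly_representing_conjugate[OF T \<open>\<epsilon> > 0\<close>])
    let ?a = "\<mu> *\<^sub>R (a - x)" and ?w = "(1 / \<mu>) *\<^sub>R (w - f)" and ?r = "r - f a - w x + f x"
    have "((?a, ?w), ?r) \<in> recentre \<mu> x f ` T"
      by (rule image_eqI[OF _ e(1)]) (simp add: recentre_def)
    moreover have "xx g - \<epsilon> < xx ?w + g ?a - ?r"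
      using e(2) \<mu> by (simp add: blinfun.bilinear_simps algebra_simps)
    ultimately show "\<exists>((a, w), r)\<in>recentre \<mu> x f ` T. blinfun_apply xx g - \<epsilon> < blinfun_apply xx w + blinfun_apply g a - r" by blast
  qed
qed

section \<open>Fenchel duality with half the squared norm\<close>

lemma half_norm_power2_le_conjugate:
  fixes f :: "'a::real_normed_vector \<Rightarrow>\<^sub>L real"
  assumes le: "\<And>z. f z \<le> (norm z)\<^sup>2 / 2 + \<gamma>"
  shows "(norm f)\<^sup>2 / 2 \<le> \<gamma>"
proof -
  have "\<gamma> \<ge> 0" using le[of 0] by (simp add: blinfun.bilinear_simps)
  have "\<bar>f z\<bar> \<le> sqrt (2 * \<gamma>) * norm z" for z
  proof (cases "z = 0")
    case False
    define n where "n = norm z"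
    have "n > 0" using False by (simp add: n_def)
    \<comment> \<open>The factor \<open>f z / n\<^sup>2\<close> maximises
      \<open>f (k z) - k^2 n^2 / 2\<close> over real \<open>k\<close>.\<close>
    have "f ((f z / n\<^sup>2) *\<^sub>R z) \<le> (f z)\<^sup>2 / n\<^sup>2 / 2 + \<gamma>"
      using le[of "(f z / n\<^sup>2) *\<^sub>R z"] \<open>n > 0\<close>
      by (simp add: power_divide power_mult_distrib power2_eq_square flip: n_def)
    then have "(f z)\<^sup>2 / n\<^sup>2 \<le> 2 * \<gamma>"
      by (simp add: blinfun.bilinear_simps power2_eq_square)
    then have "(f z)\<^sup>2 \<le> 2 * \<gamma> * n\<^sup>2" using \<open>n > 0\<close> by (simp add: field_simps)
    then have "sqrt ((f z)\<^sup>2) \<le> sqrt (2 * \<gamma> * n\<^sup>2)" by (rule real_sqrt_le_mono)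
    then show ?thesis using \<open>n > 0\<close> by (simp add: real_sqrt_mult n_def)
  qed (simp add: blinfun.bilinear_simps)
  then have "norm f \<le> sqrt (2 * \<gamma>)"
    using \<open>\<gamma> \<ge> 0\<close> by (intro norm_blinfun_bound) auto
  then have "(norm f)\<^sup>2 \<le> (sqrt (2 * \<gamma>))\<^sup>2" by (intro power_mono) auto
  then show ?thesis using \<open>\<gamma> \<ge> 0\<close> by simp
qed

lemma convex_on_half_norm_power2: "convex_on UNIV (\<lambda>z::'a::real_normed_vector. (norm z)\<^sup>2 / 2)"
  unfolding convex_on_def
proof (intro conjI convex_UNIV ballI allI impI)
  fix x y :: 'a and u v :: real assume uv: "0 \<le> u" "0 \<le> v" "u + v = 1"
  have "norm (u *\<^sub>R x + v *\<^sub>R y) \<le> u * norm x + v * norm y"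
    using norm_triangle_ineq[of "u *\<^sub>R x" "v *\<^sub>R y"] uv by simp
  then have "(norm (u *\<^sub>R x + v *\<^sub>R y))\<^sup>2 \<le> (u * norm x + v * norm y)\<^sup>2"
    by (intro power_mono) auto
  also have "\<dots> = u * (norm x)\<^sup>2 + v * (norm y)\<^sup>2 - u * v * (norm x - norm y)\<^sup>2"
  proof -
    have v: "v = 1 - u" using uv by simp
    show ?thesis unfolding v by (simp add: power2_eq_square algebra_simps)
  qed
  also have "\<dots> \<le> u * (norm x)\<^sup>2 + v * (norm y)\<^sup>2" using uv by simp
  finally show "(norm (u *\<^sub>R x + v *\<^sub>R y))\<^sup>2 / 2 \<le> u * ((norm x)\<^sup>2 / 2) + v * ((norm y)\<^sup>2 / 2)" by simp
qed

text \<open>If the infimum were at least \<epsilon>, separation would give a continuous functional,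
  that is a pair \<open>(f, xx)\<close>. The conjugate condition of \<open>T\<close> at
  \<open>(- xx, - f)\<close> then makes half the sum of the squared norms strictly smaller than
  \<open>- xx f\<close>, which is impossible.\<close>

lemma strongly_representing_near_zero:
  fixes T :: "(('a::real_normed_vector \<times> 'a dual) \<times> real) set"
  assumes T: "strongly_representing T" and "\<epsilon> > 0"
  shows "\<exists>z r. (z, r) \<in> T \<and> r + (norm z)\<^sup>2 / 2 < \<epsilon>"
proof (rule ccontr)
  assume "\<not> ?thesis"
  then have ge: "\<epsilon> \<le> snd e + (norm (fst e))\<^sup>2 / 2" if "e \<in> T" for e
    using that by (metis not_le prod.collapse)
  have "convex_on T (\<lambda>e. snd e - \<epsilon>)"
    unfolding convex_on_def
  proof (intro conjI ballI allI impI)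
    show "convex T" using T by (simp add: strongly_representing_def)
    fix x y :: "('a \<times> 'a dual) \<times> real" and u v :: real assume "0 \<le> u" "0 \<le> v" and uv: "u + v = 1"
    have "\<epsilon> = (u + v) * \<epsilon>" using uv by simp
    also have "\<dots> = u * \<epsilon> + v * \<epsilon>" by (simp add: algebra_simps)
    finally show "snd (u *\<^sub>R x + v *\<^sub>R y) - \<epsilon> \<le> u * (snd x - \<epsilon>) + v * (snd y - \<epsilon>)"
      by (simp add: algebra_simps)
  qed
  moreover have "T \<noteq> {}" using T by (simp add: strongly_representing_def)
  ultimately obtain p where p: "linear p"
    and ple: "\<And>e z. e \<in> T \<Longrightarrow> p z - p (fst e) \<le> snd e - \<epsilon> + (norm z)\<^sup>2 / 2"
    using fenchel_separation[of T "\<lambda>e. snd e - \<epsilon>" fst "\<lambda>z. (norm z)\<^sup>2 / 2",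
        OF _ linear_fst convex_on_half_norm_power2] ge by force
  obtain e0 where e0: "e0 \<in> T" using \<open>T \<noteq> {}\<close> by blast
  have bl: "bounded_linear p"
  proof (rule bounded_linear_if_bounded_above_on_ball[OF p])
    fix z :: "'a \<times> 'a dual" assume "norm z \<le> 1"
    then have "(norm z)\<^sup>2 \<le> 1" by (simp add: power_le_one)
    then show "p z \<le> p (fst e0) + snd e0 - \<epsilon> + 1" using ple[OF e0, of z] by simp
  qed
  have "bounded_linear (\<lambda>a::'a. (a, 0::'a dual))" "bounded_linear (\<lambda>w::'a dual. (0::'a, w))"
    by (intro bounded_linear_Pair bounded_linear_ident bounded_linear_zero)+
  then have bl1: "bounded_linear (\<lambda>a. p (a, 0))" and bl2: "bounded_linear (\<lambda>w. p (0, w))"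
    using bounded_linear_compose[OF bl] by blast+
  define f where "f = Blinfun (\<lambda>a. p (a, 0))"
  define xx where "xx = Blinfun (\<lambda>w. p (0, w))"
  have f: "f a = p (a, 0)" and xx: "xx w = p (0, w)" for a w
    by (simp_all add: f_def xx_def bounded_linear_Blinfun_apply bl1 bl2)
  have p_eq: "p (a, w) = f a + xx w" for a w
    using linear_add[OF p, of "(a, 0)" "(0, w)"] by (simp add: f xx)
  have "\<epsilon> / 2 > 0" using \<open>\<epsilon> > 0\<close> by simp
  then obtain a w r where e: "((a, w), r) \<in> T" "(- xx) (- f) - \<epsilon> / 2 < (- xx) w + (- f) a - r"
    by (rule strongly_representing_conjugate[OF T])
  \<comment> \<open>Separation gains \<epsilon> and the near-maximiser of the conjugate loses
    \<open>\<epsilon> / 2\<close>, so a deficit of \<open>\<epsilon> / 2\<close> remains.\<close>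
  define \<gamma> where "\<gamma> = - xx f - \<epsilon> / 2"
  have le: "f b + xx v \<le> (norm b)\<^sup>2 / 2 + (norm v)\<^sup>2 / 2 + \<gamma>" for b v
    using ple[OF e(1), of "(b, v)"] e(2)
    by (simp add: p_eq \<gamma>_def blinfun.bilinear_simps norm_Pair add_divide_distrib)
  have "(norm f)\<^sup>2 / 2 \<le> (norm v)\<^sup>2 / 2 + \<gamma> - xx v" for v
  proof (rule half_norm_power2_le_conjugate)
    show "f b \<le> (norm b)\<^sup>2 / 2 + ((norm v)\<^sup>2 / 2 + \<gamma> - xx v)" for b using le[of b v] by simp
  qed
  then have "xx v \<le> (norm v)\<^sup>2 / 2 + (\<gamma> - (norm f)\<^sup>2 / 2)" for v by (simp add: algebra_simps)
  then have "(norm xx)\<^sup>2 / 2 \<le> \<gamma> - (norm f)\<^sup>2 / 2" by (rule half_norm_power2_le_conjugate)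
  moreover have "- xx f \<le> norm xx * norm f"
    using norm_blinfun[of xx f] by (simp add: abs_le_iff)
  moreover have "norm xx * norm f \<le> (norm xx)\<^sup>2 / 2 + (norm f)\<^sup>2 / 2"
    using sum_squares_bound[of "norm xx" "norm f"] by simp
  ultimately show False using \<open>\<epsilon> > 0\<close> unfolding \<gamma>_def by linarith
qed

lemma strongly_representing_near_point:
  fixes T :: "(('a::real_normed_vector \<times> 'a dual) \<times> real) set"
  assumes T: "strongly_representing T" and "\<epsilon> > 0"
  shows "\<exists>a w r. ((a, w), r) \<in> T \<and> r - blinfun_apply f a - blinfun_apply w x + blinfun_apply f x + (norm ((a, w) - (x, f)))\<^sup>2 / 2 < \<epsilon>"
proof -
  obtain z s where zs: "(z, s) \<in> recentre 1 x f ` T" "s + (norm z)\<^sup>2 / 2 < \<epsilon>"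
    using strongly_representing_near_zero[OF strongly_representing_recentre[OF T zero_less_one, of x f] \<open>\<epsilon> > 0\<close>]
    by blast
  then obtain a w r where "((a, w), r) \<in> T" "(z, s) = recentre 1 x f ((a, w), r)" by auto
  then show ?thesis using zs(2) by (intro exI[of _ a] exI[of _ w] exI[of _ r]) (simp add: recentre_def)
qed

section \<open>From approximate to exact contact with the duality product\<close>

lemma strongly_representing_midpoint:
  assumes T: "strongly_representing T" and e: "(z, r) \<in> T" "(z', r') \<in> T"
  shows "pairing ((1 / 2) *\<^sub>R (z + z')) \<le> (r + r') / 2"
proof -
  have "convex T" using T by (simp add: strongly_representing_def)
  from convexD[OF this e, of "1/2" "1/2"]
  have "((1 / 2) *\<^sub>R (z + z'), (r + r') / 2) \<in> T"
    by (simp add: scaleR_add_right add_divide_distrib)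
  then show ?thesis by (rule strongly_representing_pairing_le[OF T])
qed

text \<open>The midpoint with a fixed \<open>z0\<close> bounds \<open>r\<close> from below by about
  \<open>- (norm z)\<^sup>2 / 4\<close>, which the term \<open>(norm z)\<^sup>2 / 2\<close>
  dominates.\<close>

lemma strongly_representing_bounded:
  fixes T :: "(('a::real_normed_vector \<times> 'a dual) \<times> real) set"
  assumes T: "strongly_representing T"
  shows "\<exists>R. \<forall>(z, r)\<in>T. r + (norm z)\<^sup>2 / 2 \<le> 1 \<longrightarrow> norm z \<le> R"
proof -
  obtain z0 r0 where e0: "(z0, r0) \<in> T" using T by (auto simp: strongly_representing_def)
  define C where "C = 4 * (1 + \<bar>r0\<bar>) + 2 * (norm z0)\<^sup>2"
  have "norm z \<le> norm z0 + sqrt C" if e: "(z, r) \<in> T" "r + (norm z)\<^sup>2 / 2 \<le> 1" for z r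
  proof -
    have "- ((norm ((1 / 2) *\<^sub>R (z + z0)))\<^sup>2 / 2) \<le> (r + r0) / 2"
      using strongly_representing_midpoint[OF T e(1) e0] abs_pairing_le[of "(1 / 2) *\<^sub>R (z + z0)"]
      by linarith
    then have "- ((norm (z + z0))\<^sup>2 / 8) \<le> (r + r0) / 2"
      by (simp add: power2_eq_square)
    moreover have "(norm (z + z0))\<^sup>2 \<le> (norm z + norm z0)\<^sup>2"
      by (intro power_mono norm_triangle_ineq) auto
    ultimately have "(norm z)\<^sup>2 / 2 \<le> 1 + r0 + (norm z + norm z0)\<^sup>2 / 4" using e(2) by argo
    then have "(norm z - norm z0)\<^sup>2 \<le> C"
      unfolding C_def power2_sum power2_diff using abs_ge_self[of r0] by argo
    then have "norm z - norm z0 \<le> sqrt C" by (rule real_le_rsqrt)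
    then show ?thesis by simp
  qed
  then show ?thesis by blast
qed

text \<open>The midpoint of \<open>z\<close> and \<open>z'\<close> bounds the recentred height of \<open>z'\<close> from below, which turns
  the estimate of \<open>strongly_representing_near_point\<close> into a bound on the distance.\<close>

lemma strongly_representing_step:
  fixes T :: "(('a::real_normed_vector \<times> 'a dual) \<times> real) set"
  assumes T: "strongly_representing T" and e: "(z, r) \<in> T" "r - pairing z \<le> \<delta>" and "\<epsilon> > 0"
  shows "\<exists>z' r'. (z', r') \<in> T \<and> r' - pairing z' \<le> \<epsilon> \<and> (norm (z' - z))\<^sup>2 \<le> 4 * (\<delta> + \<epsilon>)"
proof -
  obtain x f where z: "z = (x, f)" by (cases z)
  obtain a w r' where e': "((a, w), r') \<in> T"
    and le: "r' - f a - w x + f x + (norm ((a, w) - (x, f)))\<^sup>2 / 2 < \<epsilon>"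
    using strongly_representing_near_point[OF T \<open>\<epsilon> > 0\<close>] by blast
  define z' where "z' = (a, w)"
  define k where "k = r' - f a - w x + f x"
  have le: "k + (norm (z' - z))\<^sup>2 / 2 < \<epsilon>" using le by (simp add: z'_def k_def z)
  have k: "k - pairing (z' - z) = r' - pairing z'"
    by (simp add: k_def z z'_def blinfun.bilinear_simps)
  have "(r + r') / 2 - pairing ((1 / 2) *\<^sub>R (z + z')) = (r - pairing z) / 2 + k / 2 - pairing (z' - z) / 4"
    by (simp add: k_def z z'_def blinfun.bilinear_simps) (simp add: field_simps)
  then have "0 \<le> (r - pairing z) / 2 + k / 2 - pairing (z' - z) / 4"
    using strongly_representing_midpoint[OF T e(1) e'[folded z'_def]] by linarith
  moreover have "\<bar>pairing (z' - z)\<bar> \<le> (norm (z' - z))\<^sup>2 / 2" by (rule abs_pairing_le)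
  \<comment> \<open>The midpoint gives
    \<open>k \<ge> - \<delta> - (norm (z' - z))\<^sup>2 / 4\<close>, while \<open>le\<close> bounds
    \<open>k + (norm (z' - z))\<^sup>2 / 2\<close> by \<epsilon>; their difference leaves a quarter
    of the squared distance.\<close>
  ultimately have "(norm (z' - z))\<^sup>2 \<le> 4 * (\<delta> + \<epsilon>)" and "k - pairing (z' - z) \<le> \<epsilon>"
    using le e(2) unfolding abs_le_iff by argo+
  then show ?thesis using e'[folded z'_def] k by (intro exI[of _ z'] exI[of _ r']) simp
qed

text \<open>Each step divides the gap above the duality product by 4, so the moves shrink by 2 and
  sum to at most \<open>6 * sqrt \<epsilon>\<close>. In the limit the gap vanishes, and closedness
  of \<open>T\<close> keeps the limit point.\<close>

lemma Bronsted_Rockafellar_pairing: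
  fixes T :: "(('a::banach \<times> 'a dual) \<times> real) set"
  assumes T: "strongly_representing T" and e: "(z, r) \<in> T" "r - pairing z \<le> \<epsilon>" and "\<epsilon> > 0"
  shows "\<exists>z'. (z', pairing z') \<in> T \<and> norm (z' - z) \<le> 6 * sqrt \<epsilon>"
proof -
  define P where "P n e \<longleftrightarrow> e \<in> T \<and> snd e - pairing (fst e) \<le> \<epsilon> * (1 / 4) ^ n \<and> (n = 0 \<longrightarrow> e = (z, r))"
    for n :: nat and e
  define Q where "Q n e e' \<longleftrightarrow> norm (fst e' - fst e) \<le> (3 * sqrt \<epsilon>) * (1 / 2) ^ n"
    for n :: nat and e e' :: "('a \<times> 'a dual) \<times> real"
  have "\<exists>e'. P (Suc n) e' \<and> Q n e e'" if P: "P n e" for n e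
  proof -
    let ?\<delta> = "\<epsilon> * (1 / 4) ^ n"
    obtain z' r' where e': "(z', r') \<in> T" "r' - pairing z' \<le> \<epsilon> * (1 / 4) ^ Suc n"
      "(norm (z' - fst e))\<^sup>2 \<le> 4 * (?\<delta> + \<epsilon> * (1 / 4) ^ Suc n)"
      using strongly_representing_step[OF T, of "fst e" "snd e" ?\<delta> "\<epsilon> * (1 / 4) ^ Suc n"] P \<open>\<epsilon> > 0\<close>
      by (auto simp: P_def)
    have "4 * (?\<delta> + \<epsilon> * (1 / 4) ^ Suc n) = 5 * ?\<delta>" by simp
    \<comment> \<open>The constant is enlarged to a perfect square.\<close>
    also have "\<dots> \<le> 9 * ?\<delta>" using \<open>\<epsilon> > 0\<close> by simp
    also have "\<dots> = ((3 * sqrt \<epsilon>) * (1 / 2) ^ n)\<^sup>2"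
    proof -
      have "((1 / 2 :: real) ^ n)\<^sup>2 = (1 / 4) ^ n"
        by (simp add: power2_eq_square flip: power_mult_distrib)
      then show ?thesis using \<open>\<epsilon> > 0\<close> by (simp add: power_mult_distrib)
    qed
    finally have "(norm (z' - fst e))\<^sup>2 \<le> ((3 * sqrt \<epsilon>) * (1 / 2) ^ n)\<^sup>2" using e'(3) by linarith
    then have "norm (z' - fst e) \<le> (3 * sqrt \<epsilon>) * (1 / 2) ^ n"
      by (rule power2_le_imp_le) (use \<open>\<epsilon> > 0\<close> in simp)
    then show ?thesis using e' by (intro exI[of _ "(z', r')"]) (auto simp: P_def Q_def)
  qed
  moreover have "P 0 (z, r)" using e by (simp add: P_def)
  ultimately obtain s where s: "\<And>n. P n (s n)" "\<And>n. Q n (s n) (s (Suc n))"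
    using dependent_nat_choice[of P Q] by blast
  define y where "y n = fst (s n)" for n
  have y0: "y 0 = z" using s(1)[of 0] by (simp add: P_def y_def)
  have step: "norm (y (Suc n) - y n) \<le> (3 * sqrt \<epsilon>) * (1 / 2) ^ n" for n
    using s(2)[of n] by (simp add: Q_def y_def)
  have geo: "(\<lambda>n. (3 * sqrt \<epsilon>) * (1 / 2) ^ n) sums ((3 * sqrt \<epsilon>) * (1 / (1 - 1 / 2)))"
    by (intro sums_mult geometric_sums) auto
  have summ: "summable (\<lambda>n. norm (y (Suc n) - y n))"
    by (rule summable_comparison_test[OF _ sums_summable[OF geo]]) (use step in auto)
  define l where "l = (\<Sum>n. y (Suc n) - y n)"
  have "(\<lambda>n. y (Suc n) - y n) sums l"
    unfolding l_def using summable_norm_cancel[OF summ] by (rule summable_sums)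
  then have "(\<lambda>n. y n - y 0) \<longlonglongrightarrow> l" by (simp add: sums_def sum_lessThan_telescope)
  then have "(\<lambda>n. (y n - y 0) + y 0) \<longlonglongrightarrow> l + y 0" by (intro tendsto_add tendsto_const)
  then have lim: "y \<longlonglongrightarrow> l + z" by (simp add: y0)
  have "norm l \<le> (\<Sum>n. norm (y (Suc n) - y n))" unfolding l_def by (rule summable_norm[OF summ])
  also have "\<dots> \<le> (\<Sum>n. (3 * sqrt \<epsilon>) * (1 / 2) ^ n)"
    by (intro suminf_le step summ sums_summable[OF geo])
  also have "\<dots> = 6 * sqrt \<epsilon>" using sums_unique[OF geo] by simp
  finally have "norm (l + z - z) \<le> 6 * sqrt \<epsilon>" by simp
  moreover have "(l + z, pairing (l + z)) \<in> T"
  proof -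
    have gap: "(\<lambda>n. snd (s n) - pairing (y n)) \<longlonglongrightarrow> 0"
    proof (rule tendsto_sandwich)
      show "\<forall>\<^sub>F n in sequentially. 0 \<le> snd (s n) - pairing (y n)"
        using strongly_representing_pairing_le[OF T] s(1) unfolding P_def y_def
        by (metis (no_types, lifting) diff_ge_0_iff_ge eventuallyI prod.collapse)
      show "\<forall>\<^sub>F n in sequentially. snd (s n) - pairing (y n) \<le> \<epsilon> * (1 / 4) ^ n"
        using s(1) by (simp add: P_def y_def)
      show "(\<lambda>n. \<epsilon> * (1 / 4) ^ n) \<longlonglongrightarrow> 0"
        by (intro tendsto_mult_right_zero LIMSEQ_power_zero) simp
    qed simp
    have "(\<lambda>n. (snd (s n) - pairing (y n)) + pairing (y n)) \<longlonglongrightarrow> 0 + pairing (l + z)"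
      by (intro tendsto_add gap tendsto_pairing lim)
    then have "(\<lambda>n. (y n, snd (s n))) \<longlonglongrightarrow> (l + z, pairing (l + z))"
      by (intro tendsto_Pair lim) simp
    moreover have "(y n, snd (s n)) \<in> T" for n using s(1)[of n] by (simp add: P_def y_def)
    ultimately show ?thesis
      using T closed_sequentially[of T "\<lambda>n. (y n, snd (s n))"] by (simp add: strongly_representing_def)
  qed
  ultimately show ?thesis by blast
qed

text \<open>A near-minimiser at tolerance \<open>s\<^sup>2\<close> has gap at most
  \<open>s\<^sup>2\<close>, hence lies within \<open>6 * s\<close> of an exact point. The a priori
  bound \<open>R\<close> makes the resulting change of the objective linear in
  \<open>s\<close>.\<close>

lemma strongly_representing_near_zero_exact:
  fixes T :: "(('a::banach \<times> 'a dual) \<times> real) set"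
  assumes T: "strongly_representing T" and "\<epsilon> > 0"
  shows "\<exists>z. (z, pairing z) \<in> T \<and> pairing z + (norm z)\<^sup>2 / 2 < \<epsilon>"
proof -
  obtain R where R: "\<And>z r. (z, r) \<in> T \<Longrightarrow> r + (norm z)\<^sup>2 / 2 \<le> 1 \<Longrightarrow> norm z \<le> R"
    using strongly_representing_bounded[OF T] by blast
  \<comment> \<open>This covers 1 from \<open>s\<^sup>2 \<le> s\<close> and
    \<open>(3 / 2) * 6 * (2 * \<bar>R\<bar> + 6)\<close> from the displacement; 3/2 collects the
    pairing and half the squared norm.\<close>
  define C where "C = 56 + 18 * \<bar>R\<bar>"
  define s where "s = min 1 (\<epsilon> / C)"
  have "C > 0" by (simp add: C_def)
  have s: "s > 0" "s \<le> 1" "s * C \<le> \<epsilon>" using \<open>\<epsilon> > 0\<close> \<open>C > 0\<close> by (auto simp: s_def min_def field_simps)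
  have "s\<^sup>2 \<le> s" using s by (simp add: power2_eq_square mult_left_le)
  obtain z r where e: "(z, r) \<in> T" "r + (norm z)\<^sup>2 / 2 < s\<^sup>2"
    using strongly_representing_near_zero[OF T, of "s\<^sup>2"] s by auto
  have zR: "norm z \<le> \<bar>R\<bar>" using R[OF e(1)] e(2) \<open>s\<^sup>2 \<le> s\<close> s by linarith
  have "r - pairing z \<le> s\<^sup>2" using e(2) abs_pairing_le[of z] by linarith
  then obtain z' where z': "(z', pairing z') \<in> T" "norm (z' - z) \<le> 6 * sqrt (s\<^sup>2)"
    using Bronsted_Rockafellar_pairing[OF T e(1)] s by (metis zero_less_power)
  define d where "d = norm (z' - z)"
  have d: "0 \<le> d" "d \<le> 6 * s" using z'(2) s by (auto simp: d_def)
  have z'n: "norm z' \<le> norm z + d" unfolding d_def by (rule norm_triangle_sub)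
  have "pairing z \<le> r" by (rule strongly_representing_pairing_le[OF T e(1)])
  have "pairing z' \<le> pairing z + d * (norm z + norm z')"
    using abs_pairing_diff_le[of z' z] by (simp add: d_def abs_le_iff)
  moreover have "(norm z')\<^sup>2 - (norm z)\<^sup>2 \<le> d * (norm z + norm z')"
  proof -
    have "(norm z')\<^sup>2 - (norm z)\<^sup>2 = (norm z' - norm z) * (norm z + norm z')"
      by (simp add: power2_eq_square algebra_simps)
    also have "\<dots> \<le> d * (norm z + norm z')" using z'n by (intro mult_right_mono) auto
    finally show ?thesis .
  qed
  moreover have "d * (norm z + norm z') \<le> (6 * s) * (2 * \<bar>R\<bar> + 6)"
    using d zR z'n s by (intro mult_mono) auto
  ultimately have "pairing z' + (norm z')\<^sup>2 / 2 < s\<^sup>2 + (3 / 2) * ((6 * s) * (2 * \<bar>R\<bar> + 6))"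
    using e(2) \<open>pairing z \<le> r\<close> by linarith
  also have "\<dots> \<le> s * C" using \<open>s\<^sup>2 \<le> s\<close> s by (simp add: C_def algebra_simps)
  also have "\<dots> \<le> \<epsilon>" by (rule s(3))
  finally show ?thesis using z' by blast
qed

text \<open>Recentring at \<open>(0, f)\<close> with factor \<open>t\<close> preserves exact contact
  with the duality product and gives the two norms reciprocal weights.\<close>

lemma strongly_representing_scaled:
  fixes T :: "(('a::banach \<times> 'a dual) \<times> real) set"
  assumes T: "strongly_representing T" and "\<epsilon> > 0" and t: "t > 0"
  shows "\<exists>a w. ((a, w), blinfun_apply w a) \<in> T \<and> blinfun_apply (w - f) a + t\<^sup>2 * (norm a)\<^sup>2 / 2 + (norm (w - f))\<^sup>2 / (2 * t\<^sup>2) < \<epsilon>"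
proof -
  obtain z where z: "(z, pairing z) \<in> recentre t 0 f ` T" "pairing z + (norm z)\<^sup>2 / 2 < \<epsilon>"
    using strongly_representing_near_zero_exact[OF strongly_representing_recentre[OF T t, of 0 f] \<open>\<epsilon> > 0\<close>]
    by blast
  then obtain a w r where e: "((a, w), r) \<in> T" "(z, pairing z) = recentre t 0 f ((a, w), r)" by auto
  then have zz: "z = (t *\<^sub>R a, (1 / t) *\<^sub>R (w - f))" "pairing z = r - f a"
    by (auto simp: recentre_def blinfun.bilinear_simps)
  then have r: "r = w a" using t by (simp add: blinfun.bilinear_simps)
  then have "blinfun_apply (w - f) a = pairing z" by (simp add: zz(2) blinfun.diff_left)
  moreover have "(norm z)\<^sup>2 / 2 = t\<^sup>2 * (norm a)\<^sup>2 / 2 + (norm (w - f))\<^sup>2 / (2 * t\<^sup>2)"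
    using t by (simp add: zz norm_Pair power_mult_distrib power_divide add_divide_distrib)
  ultimately have "blinfun_apply (w - f) a + t\<^sup>2 * (norm a)\<^sup>2 / 2 + (norm (w - f))\<^sup>2 / (2 * t\<^sup>2) < \<epsilon>"
    using z(2) by (simp only: add.assoc)
  then show ?thesis using e(1) unfolding r by blast
qed

lemma le_of_linear_perturbation:
  fixes x y C :: real
  assumes "\<And>t. 0 < t \<Longrightarrow> t \<le> 1 \<Longrightarrow> x \<le> y + t * C"
  shows "x \<le> y"
proof (rule tendsto_upperbound)
  show "((\<lambda>t. x - t * C) \<longlongrightarrow> x) (at_right 0)"
    by (rule tendsto_eq_intros refl | simp)+
  have "\<forall>\<^sub>F t::real in at_right 0. 0 < t \<and> t \<le> 1"
    unfolding eventually_at_right_field by (intro exI[of _ 1]) auto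
  then show "\<forall>\<^sub>F t in at_right 0. x - t * C \<le> y"
    by (rule eventually_mono) (use assms in force)
qed simp

text \<open>\<open>T\<close> lies above the duality product and touches it at \<open>(a, w)\<close>.
  Along the segment to \<open>((y, v), s)\<close> the first-order terms give the inequality, and the
  quadratic term disappears as \<open>t\<close> tends to 0.\<close>

lemma strongly_representing_subgradient:
  assumes T: "strongly_representing T" and e: "((a, w), blinfun_apply w a) \<in> T" "((y, v), s) \<in> T"
  shows "w y + v a - s \<le> w a"
proof -
  let ?q = "(v - w) (y - a)"
  have "w y + v a - w a \<le> s + t * (- ?q)" if t: "0 < t" "t \<le> 1" for t
  proof -
    have "convex T" using T by (simp add: strongly_representing_def)
    from convexD[OF this e, of "1 - t" t] t
    have "(((1 - t) *\<^sub>R a + t *\<^sub>R y, (1 - t) *\<^sub>R w + t *\<^sub>R v), (1 - t) * w a + t * s) \<in> T"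
      by simp
    from strongly_representing_pairing_le[OF T this]
    have "((1 - t) *\<^sub>R w + t *\<^sub>R v) ((1 - t) *\<^sub>R a + t *\<^sub>R y) \<le> (1 - t) * w a + t * s" by simp
    moreover have "((1 - t) *\<^sub>R w + t *\<^sub>R v) ((1 - t) *\<^sub>R a + t *\<^sub>R y)
      = (1 - t) * w a + t * (w y + v a - w a + t * ?q)"
      by (simp add: blinfun.bilinear_simps algebra_simps)
    ultimately have "t * (w y + v a - w a + t * ?q) \<le> t * s" by linarith
    then have "w y + v a - w a + t * ?q \<le> s" using t by simp
    then show ?thesis by simp
  qed
  then have "w y + v a - w a \<le> s" by (rule le_of_linear_perturbation)
  then show ?thesis by simp
qed

section \<open>Sums of operators\<close>

lemma maximally_monotone_mem:
  assumes A: "maximally_monotone A"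
    and rel: "\<And>b v. (b, v) \<in> gra A \<Longrightarrow> 0 \<le> blinfun_apply (f - v) (x - b)"
  shows "(x, f) \<in> gra A"
proof -
  define B where "B y = (if y = x then insert f (A x) else A y)" for y
  have graB: "gra B = insert (x, f) (gra A)" by (auto simp: gra_def B_def split: if_splits)
  have mon: "0 \<le> blinfun_apply (u - v) (a - b)" if "(a, u) \<in> gra A" "(b, v) \<in> gra A" for a b u v
    using A that by (auto simp: maximally_monotone_def monotone_op_def)
  have rel': "0 \<le> blinfun_apply (v - f) (b - x)" if "(b, v) \<in> gra A" for b v
    using rel[OF that] by (simp add: blinfun.bilinear_simps algebra_simps)
  have "monotone_op B"
    unfolding monotone_op_def graB using mon rel rel' by (auto simp: blinfun.zero_left)
  then have "gra B = gra A" using A graB unfolding maximally_monotone_def by blast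
  then show ?thesis using graB by blast
qed

text \<open>A norming functional for \<open>x - y\<close> comes from separating on a singleton.\<close>

lemma canonical_embedding_inj:
  assumes "canonical_embedding x = canonical_embedding y"
  shows "x = y"
proof -
  let ?d = "x - y"
  have "\<exists>p. linear p \<and> (\<forall>e\<in>{?d}. \<forall>z. p z - p e \<le> - norm ?d + norm z)"
  proof (rule fenchel_separation)
    show "convex_on {?d} (\<lambda>_. - norm ?d)" by (simp add: convex_on_const)
    show "convex_on UNIV (\<lambda>z :: 'a. norm z)" using convex_on_dist[of UNIV 0] by (simp add: dist_norm)
  qed (auto simp: linear_id[unfolded id_def])
  then obtain p where p: "linear p" "\<And>z. p z - p ?d \<le> - norm ?d + norm z" by blast
  have "bounded_linear p"
    by (rule bounded_linear_if_bounded_above_on_ball[OF p(1), of "p ?d - norm ?d + 1"])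
      (use p(2) in \<open>smt (verit)\<close>)
  then have "p ?d = canonical_embedding x (Blinfun p) - canonical_embedding y (Blinfun p)"
    by (simp add: bounded_linear_Blinfun_apply linear_diff[OF p(1)])
  then have "norm ?d \<le> 0" using p(2)[of 0] assms linear_0[OF p(1)] by simp
  then show ?thesis by simp
qed

text \<open>Stands in for the epigraph of a closed convex envelope. Leaving out the vertical
  direction does not change the suprema that define conjugates.\<close>

definition graph_hull :: "'a::real_normed_vector operator \<Rightarrow> (('a \<times> 'a dual) \<times> real) set" where
  "graph_hull A = closure (convex hull ((\<lambda>z. (z, pairing z)) ` gra A))"

lemma graph_hull_minimal:
  assumes "closed S" "convex S" and "\<And>z. z \<in> gra A \<Longrightarrow> (z, pairing z) \<in> S"
  shows "graph_hull A \<subseteq> S"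
  unfolding graph_hull_def using assms by (intro closure_minimal hull_minimal) auto

lemma graph_hull_inc: "z \<in> gra A \<Longrightarrow> (z, pairing z) \<in> graph_hull A"
  unfolding graph_hull_def by (intro subsetD[OF closure_subset] hull_inc imageI)

lemma closed_graph_hull: "closed (graph_hull A)"
  and convex_graph_hull: "convex (graph_hull A)"
  by (auto simp: graph_hull_def intro: convex_closure convex_convex_hull)

text \<open>A bound on an affine function cuts out a closed half-space, so it passes from the graph
  to its hull.\<close>

lemma graph_hull_conjugate_le:
  fixes xx :: "'a::real_normed_vector bidual" and f :: "'a dual"
  assumes le: "\<And>a u. (a, u) \<in> gra A \<Longrightarrow> blinfun_apply xx u + blinfun_apply f a - blinfun_apply u a \<le> c"
    and e: "((a, u), r) \<in> graph_hull A"
  shows "xx u + f a - r \<le> c"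
proof -
  let ?S = "{e :: ('a \<times> 'a dual) \<times> real. xx (snd (fst e)) + f (fst (fst e)) - snd e \<le> c}"
  have "graph_hull A \<subseteq> ?S"
  proof (rule graph_hull_minimal)
    show "closed ?S" by (intro closed_Collect_le continuous_intros)
    show "convex ?S"
    proof (rule convexI)
      fix x y and s t :: real
      assume xy: "x \<in> ?S" "y \<in> ?S" and st: "0 \<le> s" "0 \<le> t" "s + t = 1"
      define k where "k e = xx (snd (fst e)) + f (fst (fst e)) - snd e" for e :: "('a \<times> 'a dual) \<times> real"
      have "k (s *\<^sub>R x + t *\<^sub>R y) = s * k x + t * k y"
        by (simp add: k_def blinfun.bilinear_simps algebra_simps)
      also have "\<dots> \<le> c" using xy st by (intro convex_bound_le) (auto simp: k_def)
      finally show "s *\<^sub>R x + t *\<^sub>R y \<in> ?S" by (simp add: k_def)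
    qed
    show "(z, pairing z) \<in> ?S" if "z \<in> gra A" for z using le that by (cases z) auto
  qed
  then show ?thesis using e by auto
qed

text \<open>Monotonicity bounds the conjugate at each graph point by the pairing there. A hull point
  below the duality product would thus be related to every graph point with a uniform positive gap;
  maximality puts it in the graph, where the gap to itself is 0.\<close>

lemma graph_hull_pairing_le:
  assumes A: "maximally_monotone A" and e: "((a, u), r) \<in> graph_hull A"
  shows "u a \<le> r"
proof (rule ccontr)
  assume less: "\<not> u a \<le> r"
  have gap: "u a - r \<le> blinfun_apply (u - v) (a - b)" if bv: "(b, v) \<in> gra A" for b v
  proof -
    have "canonical_embedding b u' + v a' - u' a' \<le> v b" if "(a', u') \<in> gra A" for a' u'
    proof -
      have "0 \<le> blinfun_apply (u' - v) (a' - b)"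
        using A that bv by (auto simp: maximally_monotone_def monotone_op_def)
      then show ?thesis by (simp add: blinfun.bilinear_simps algebra_simps)
    qed
    from graph_hull_conjugate_le[OF this e]
    show ?thesis by (simp add: blinfun.bilinear_simps algebra_simps)
  qed
  have "(a, u) \<in> gra A"
  proof (rule maximally_monotone_mem[OF A])
    fix b v assume "(b, v) \<in> gra A"
    from gap[OF this] less show "0 \<le> blinfun_apply (u - v) (a - b)" by linarith
  qed
  from gap[OF this] less show False by (simp add: blinfun.zero_left)
qed

text \<open>Having first component in a translate of \<open>L\<close> is a closed convex condition,
  so it passes to the two hulls one after the other.\<close>

lemma graph_hull_fst_diff:
  assumes L: "closed L" "subspace L"
    and dom: "\<And>a b. a \<in> op_dom A \<Longrightarrow> b \<in> op_dom B \<Longrightarrow> a - b \<in> L"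
    and e: "((a, u), r) \<in> graph_hull A" "((b, v), s) \<in> graph_hull B"
  shows "a - b \<in> L"
proof -
  have *: "closed {e :: ('a \<times> 'a dual) \<times> real. fst (fst e) - c \<in> L}"
      "convex {e :: ('a \<times> 'a dual) \<times> real. fst (fst e) - c \<in> L}" for c
  proof -
    have "closed ((\<lambda>e :: ('a \<times> 'a dual) \<times> real. fst (fst e) - c) -` L)"
      by (intro continuous_closed_vimage L(1) continuous_intros)
    then show "closed {e :: ('a \<times> 'a dual) \<times> real. fst (fst e) - c \<in> L}" by (simp add: vimage_def)
    show "convex {e :: ('a \<times> 'a dual) \<times> real. fst (fst e) - c \<in> L}"
    proof (rule convexI)
      fix x y :: "('a \<times> 'a dual) \<times> real" and p q :: real
      assume xy: "x \<in> {e. fst (fst e) - c \<in> L}" "y \<in> {e. fst (fst e) - c \<in> L}" and pq: "p + q = 1"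
      have c: "p *\<^sub>R c + q *\<^sub>R c = c" using pq by (simp flip: scaleR_add_left)
      have "fst (fst (p *\<^sub>R x + q *\<^sub>R y)) - c
          = p *\<^sub>R fst (fst x) + q *\<^sub>R fst (fst y) - (p *\<^sub>R c + q *\<^sub>R c)"
        unfolding c by simp
      also have "\<dots> = p *\<^sub>R (fst (fst x) - c) + q *\<^sub>R (fst (fst y) - c)"
        by (simp add: algebra_simps)
      also have "\<dots> \<in> L" using xy by (intro subspace_add subspace_scale L(2)) auto
      finally show "p *\<^sub>R x + q *\<^sub>R y \<in> {e. fst (fst e) - c \<in> L}" by simp
    qed
  qed
  have neg: "x - y \<in> L \<longleftrightarrow> y - x \<in> L" for x y
    using subspace_neg[OF L(2), of "x - y"] subspace_neg[OF L(2), of "y - x"] by auto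
  have domI: "fst z \<in> op_dom C" if "z \<in> gra C" for z and C :: "'a operator"
    using that by (auto simp: gra_def op_dom_def)
  have 1: "a - b \<in> L" if "b \<in> op_dom B" for b
  proof -
    have "graph_hull A \<subseteq> {e. fst (fst e) - b \<in> L}"
      by (rule graph_hull_minimal[OF *]) (use dom[OF domI that] in auto)
    then show ?thesis using e(1) by auto
  qed
  have "graph_hull B \<subseteq> {e. fst (fst e) - a \<in> L}"
    by (rule graph_hull_minimal[OF *]) (use 1[OF domI] neg in auto)
  then show ?thesis using e(2) neg by auto
qed

lemma monotone_op_sum:
  assumes "monotone_op A" "monotone_op B"
  shows "monotone_op (op_sum A B)"
proof -
  have "0 \<le> blinfun_apply ((u + v) - (u' + v')) (x - x')"
    if m: "u \<in> A x" "v \<in> B x" "u' \<in> A x'" "v' \<in> B x'" for x x' u v u' v'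
  proof -
    have "0 \<le> blinfun_apply (u - u') (x - x')" "0 \<le> blinfun_apply (v - v') (x - x')"
      using assms m by (auto simp: monotone_op_def gra_def)
    then show ?thesis by (simp add: blinfun.bilinear_simps)
  qed
  then show ?thesis by (auto simp: monotone_op_def gra_def op_sum_def)
qed

lemma type_NI_approx:
  assumes "type_NI B" and "\<eta> > 0"
  obtains b v where "(b, v) \<in> gra B" "blinfun_apply (xx - canonical_embedding b) (f - v) < \<eta>"
proof -
  have "(INF (b, v)\<in>gra B. ereal (blinfun_apply (xx - canonical_embedding b) (f - v))) \<le> 0"
    using assms(1) by (simp add: type_NI_def)
  also have "0 < ereal \<eta>" using \<open>\<eta> > 0\<close> by simp
  finally show thesis using that by (auto simp: INF_less_iff)
qed

text \<open>The real arithmetic of \<open>monotonically_related_bound\<close>: \<open>n\<close>,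
  \<open>b\<close>, \<open>E\<close> and \<open>t * x\<close> are the norms of \<open>a\<close>,
  \<open>xx\<close>, \<open>e\<close> and \<open>h\<close>, and \<alpha>, \<beta>, \<gamma>,
  \<delta> are \<open>h a\<close>, \<open>xx h\<close>, \<open>xx e\<close>, \<open>e a\<close>. The
  tolerance \<open>t\<^sup>2\<close> leaves an error of order \<open>t\<close> after division of
  \<open>rel\<close> by \<open>t\<close>.\<close>

lemma scaled_approximation_estimates:
  fixes t x n b E \<alpha> \<beta> \<gamma> \<delta> :: real
  assumes t: "0 < t" "t \<le> 1" and pos: "0 \<le> b" "0 \<le> E"
    and \<beta>: "\<bar>\<beta>\<bar> \<le> b * (t * x)" and \<gamma>: "\<bar>\<gamma>\<bar> \<le> b * E" and \<delta>: "\<bar>\<delta>\<bar> \<le> E * n"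
    and small: "\<alpha> + t\<^sup>2 * n\<^sup>2 / 2 + x\<^sup>2 / 2 < t\<^sup>2" and rel: "0 \<le> \<alpha> - \<beta> + t * (\<delta> - \<gamma>)"
  shows "\<alpha> - \<beta> \<le> t * (1 + b\<^sup>2 / 2)" and "- (t * (1 + b\<^sup>2 / 2)) \<le> \<delta> - \<gamma>"
    and "x \<le> 2 * sqrt (b\<^sup>2 + (1 + E\<^sup>2 / 2 + E * b))"
proof -
  \<comment> \<open>The first splitting consumes \<open>x\<^sup>2 / 2\<close> and bounds
    \<open>\<alpha> - \<beta>\<close>; the second leaves \<open>x\<^sup>2 / 4\<close>, from which
    \<open>x\<close> is bounded.\<close>
  have young: "b * (t * x) \<le> x\<^sup>2 / 2 + t\<^sup>2 * b\<^sup>2 / 2" "b * (t * x) \<le> x\<^sup>2 / 4 + t\<^sup>2 * b\<^sup>2"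
    using sum_squares_bound[of x "t * b"] sum_squares_bound[of "x / 2" "t * b"]
    by (simp_all add: power_mult_distrib power_divide mult_ac)
  have "0 \<le> t\<^sup>2 * n\<^sup>2 / 2" by simp
  then have "\<alpha> - \<beta> \<le> t\<^sup>2 + t\<^sup>2 * b\<^sup>2 / 2" using small \<beta> young(1) unfolding abs_le_iff by argo
  then have low: "\<alpha> - \<beta> \<le> t * (t * (1 + b\<^sup>2 / 2))" by (simp add: power2_eq_square algebra_simps)
  have "t * (t * (1 + b\<^sup>2 / 2)) \<le> t * (1 + b\<^sup>2 / 2)" using t by (intro mult_left_le_one_le) auto
  with low show "\<alpha> - \<beta> \<le> t * (1 + b\<^sup>2 / 2)" by linarith
  have "0 \<le> t * (t * (1 + b\<^sup>2 / 2)) + t * (\<delta> - \<gamma>)" using low rel by linarith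
  then have "0 \<le> t * (t * (1 + b\<^sup>2 / 2) + (\<delta> - \<gamma>))" by (simp only: distrib_left)
  then show "- (t * (1 + b\<^sup>2 / 2)) \<le> \<delta> - \<gamma>" using t by (simp add: zero_le_mult_iff)
  have t2: "t\<^sup>2 \<le> 1" using t by (simp add: power_le_one)
  have "t * (\<delta> - \<gamma>) \<le> t * (E * n + b * E)"
    using \<gamma> \<delta> t by (intro mult_left_mono) (auto simp: abs_le_iff)
  also have "\<dots> = E * (t * n) + t * (b * E)" by (simp add: algebra_simps)
  also have "E * (t * n) \<le> E\<^sup>2 / 2 + t\<^sup>2 * n\<^sup>2 / 2"
    using sum_squares_bound[of E "t * n"] by (simp add: power_mult_distrib)
  also have "t * (b * E) \<le> b * E" using t pos by (intro mult_left_le_one_le) auto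
  finally have "t * (\<delta> - \<gamma>) \<le> E\<^sup>2 / 2 + t\<^sup>2 * n\<^sup>2 / 2 + b * E" by simp
  then have "x\<^sup>2 / 4 \<le> t\<^sup>2 * b\<^sup>2 + (1 + E\<^sup>2 / 2 + b * E)"
    using rel small \<beta> young(2) t2 unfolding abs_le_iff by argo
  also have "t\<^sup>2 * b\<^sup>2 \<le> b\<^sup>2" using t2 by (intro mult_left_le_one_le) auto
  finally have "(x / 2)\<^sup>2 \<le> b\<^sup>2 + (1 + E\<^sup>2 / 2 + E * b)" by (simp add: power_divide mult.commute)
  then have "x / 2 \<le> sqrt (b\<^sup>2 + (1 + E\<^sup>2 / 2 + E * b))" by (rule real_le_rsqrt)
  then show "x \<le> 2 * sqrt (b\<^sup>2 + (1 + E\<^sup>2 / 2 + E * b))" by simp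
qed

section \<open>Conjugates and exact points for the sum of an ultramaximal operator and one of type
  (NI)\<close>

locale ultramaximal_NI_pair =
  fixes A B :: "'a::banach operator" and L :: "'a set"
  assumes A: "maximally_monotone A" and B: "maximally_monotone B"
    and L_def: "L = (\<Union>t\<in>{0<..}. (\<lambda>z. t *\<^sub>R z) ` set_diff (op_dom A) (op_dom B))"
    and L: "closed L" "subspace L"
    and ultra: "ultramaximally_monotone A" and NI: "type_NI B"
begin

definition sum_epi :: "(('a \<times> 'a dual) \<times> real) set" where
  "sum_epi = {((a, u + v), r + s) | a u v r s. ((a, u), r) \<in> graph_hull A \<and> ((a, v), s) \<in> graph_hull B}"

lemma dom_diff: "a - b \<in> L" if "a \<in> op_dom A" "b \<in> op_dom B"
proof -
  have "1 *\<^sub>R (a - b) \<in> L" unfolding L_def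
    by (rule UN_I[of "1::real"]) (use that in \<open>auto simp: set_diff_def simp del: scaleR_one\<close>)
  then show ?thesis by simp
qed

lemma hull_diff: "a - b \<in> L" if "((a, u), r) \<in> graph_hull A" "((b, v), s) \<in> graph_hull B"
  using graph_hull_fst_diff[OF L dom_diff that] .

text \<open>Passing from the domains to the hulls does not enlarge the cone, so the constraint
  qualification takes the form that \<open>attouch_brezis_multiplier\<close> requires.\<close>

lemma cone_hull:
  "L = (\<Union>t\<in>{0<..}. (\<lambda>z. t *\<^sub>R z) ` (\<lambda>e. fst (fst (fst e)) - fst (fst (snd e))) ` (graph_hull A \<times> graph_hull B))"
  (is "L = (\<Union>t\<in>_. _ ` ?G ` ?K)")
proof (intro equalityI subsetI)
  fix d assume "d \<in> L"
  then obtain t a b where d: "t > 0" "a \<in> op_dom A" "b \<in> op_dom B" "d = t *\<^sub>R (a - b)"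
    unfolding L_def set_diff_def by auto
  then obtain u v where "(a, u) \<in> gra A" "(b, v) \<in> gra B" by (auto simp: op_dom_def gra_def)
  then have "(((a, u), pairing (a, u)), ((b, v), pairing (b, v))) \<in> ?K"
    by (intro SigmaI graph_hull_inc)
  then have "?G (((a, u), pairing (a, u)), ((b, v), pairing (b, v))) \<in> ?G ` ?K" by (rule imageI)
  then have "a - b \<in> ?G ` ?K" by simp
  then show "d \<in> (\<Union>t\<in>{0<..}. (\<lambda>z. t *\<^sub>R z) ` ?G ` ?K)"
    using d(1) unfolding d(4) by (intro UN_I[of t] imageI) auto
next
  fix d assume "d \<in> (\<Union>t\<in>{0<..}. (\<lambda>z. t *\<^sub>R z) ` ?G ` ?K)"
  then obtain t k where k: "k \<in> ?K" "d = t *\<^sub>R ?G k" by blast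
  define e e' where "e = fst k" and "e' = snd k"
  have d: "e \<in> graph_hull A" "e' \<in> graph_hull B" "d = t *\<^sub>R (fst (fst e) - fst (fst e'))"
    using k by (auto simp: e_def e'_def)
  have "fst (fst e) - fst (fst e') \<in> L"
    using hull_diff[of "fst (fst e)" "snd (fst e)" "snd e" "fst (fst e')" "snd (fst e')" "snd e'"] d by simp
  then show "d \<in> L" unfolding d(3) by (rule subspace_scale[OF L(2)])
qed

text \<open>\<open>sum_epi\<close> arises from pairs of hull points with a common first component.
  The multiplier of this constraint, added to \<open>f\<close>, is the functional \<open>g\<close>
  that splits the conjugate bound.\<close>

lemma sum_epi_conjugate_split:
  fixes xx :: "'a bidual" and f :: "'a dual"
  assumes le: "\<And>a w r. ((a, w), r) \<in> sum_epi \<Longrightarrow> blinfun_apply xx w + blinfun_apply f a - r \<le> c"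
  shows "\<exists>g. \<forall>(a, u)\<in>gra A. \<forall>(b, v)\<in>gra B. xx f - c \<le>
    blinfun_apply (xx - canonical_embedding a) (g - u) + blinfun_apply (xx - canonical_embedding b) ((f - g) - v)"
proof -
  let ?G = "\<lambda>e :: (('a \<times> 'a dual) \<times> real) \<times> (('a \<times> 'a dual) \<times> real). fst (fst (fst e)) - fst (fst (snd e))"
  let ?\<phi> = "\<lambda>e :: (('a \<times> 'a dual) \<times> real) \<times> (('a \<times> 'a dual) \<times> real).
    snd (fst e) + snd (snd e) - xx (snd (fst (fst e))) - xx (snd (fst (snd e))) - f (fst (fst (fst e)))"
  have "\<exists>p. bounded_linear p \<and> (\<forall>e\<in>graph_hull A \<times> graph_hull B. p (?G e) \<le> ?\<phi> e + c)"
  proof (rule attouch_brezis_multiplier[OF _ _ _ L cone_hull])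
    show "bounded_linear ?G" "bounded_linear ?\<phi>"
      by (intro bounded_linear_intros)+
    show "closed (graph_hull A \<times> graph_hull B)" by (intro closed_Times closed_graph_hull)
    show "convex (graph_hull A \<times> graph_hull B)" by (intro convex_Times convex_graph_hull)
    fix e assume e: "e \<in> graph_hull A \<times> graph_hull B" "?G e = 0"
    obtain a u r b v s where ee: "e = (((a, u), r), ((b, v), s))" by (metis surj_pair)
    have "((a, u + v), r + s) \<in> sum_epi" using e unfolding ee sum_epi_def by auto
    from le[OF this] show "0 \<le> ?\<phi> e + c" by (simp add: ee blinfun.bilinear_simps)
  qed
  then obtain p where bl: "bounded_linear p"
    and p: "\<And>e. e \<in> graph_hull A \<times> graph_hull B \<Longrightarrow> p (?G e) \<le> ?\<phi> e + c" by blast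
  define P where "P = Blinfun p"
  have P: "blinfun_apply P = p" by (simp add: P_def bounded_linear_Blinfun_apply bl)
  have "xx f - c \<le> blinfun_apply (xx - canonical_embedding a) ((f + P) - u)
      + blinfun_apply (xx - canonical_embedding b) ((f - (f + P)) - v)"
    if "(a, u) \<in> gra A" "(b, v) \<in> gra B" for a u b v
  proof -
    have "(((a, u), pairing (a, u)), ((b, v), pairing (b, v))) \<in> graph_hull A \<times> graph_hull B"
      using that by (intro SigmaI graph_hull_inc)
    from p[OF this] have "P (a - b) \<le> u a + v b - xx u - xx v - f a + c" by (simp add: P)
    then show ?thesis by (simp add: blinfun.bilinear_simps algebra_simps)
  qed
  then show ?thesis by (intro exI[of _ "f + P"]) auto
qed

text \<open>Type (NI) makes the contribution of \<open>B\<close> arbitrarily small, so that of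
  \<open>A\<close> is at least \<open>xx f - c\<close>, and ultramaximality gives
  \<open>(x, g)\<close> in the graph of \<open>A\<close>. At this point the contribution of
  \<open>A\<close> vanishes, which forces \<open>c = xx f\<close> and leaves
  \<open>(x, f - g)\<close> monotonically related to \<open>B\<close>.\<close>

lemma sum_epi_conjugate:
  fixes xx :: "'a bidual" and f :: "'a dual"
  assumes le: "\<And>a w r. ((a, w), r) \<in> sum_epi \<Longrightarrow> blinfun_apply xx w + blinfun_apply f a - r \<le> c"
    and c: "c \<le> xx f"
  shows "c = xx f \<and> (\<exists>x. xx = canonical_embedding x \<and> (x, f) \<in> gra (op_sum A B))"
proof -
  obtain g where g: "\<And>a u b v. (a, u) \<in> gra A \<Longrightarrow> (b, v) \<in> gra B \<Longrightarrow> xx f - c \<le>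
    blinfun_apply (xx - canonical_embedding a) (g - u) + blinfun_apply (xx - canonical_embedding b) ((f - g) - v)"
    using sum_epi_conjugate_split[OF le] by blast
  have ge: "xx f - c \<le> blinfun_apply (xx - canonical_embedding a) (g - u)" if "(a, u) \<in> gra A" for a u
  proof (rule field_le_epsilon)
    fix \<eta> :: real assume "\<eta> > 0"
    then obtain b v where "(b, v) \<in> gra B" "blinfun_apply (xx - canonical_embedding b) ((f - g) - v) < \<eta>"
      by (rule type_NI_approx[OF NI])
    with g[OF that this(1)]
    show "xx f - c \<le> blinfun_apply (xx - canonical_embedding a) (g - u) + \<eta>" by linarith
  qed
  have "0 \<le> blinfun_apply (xx - canonical_embedding a) (g - u)" if "(a, u) \<in> gra A" for a u
    using ge[OF that] c by linarith
  then obtain x where x: "xx = canonical_embedding x" "(x, g) \<in> gra A"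
    using ultra unfolding ultramaximally_monotone_def by blast
  have "c = xx f" using ge[OF x(2)] c by (simp add: x(1) blinfun.bilinear_simps)
  moreover have "(x, f - g) \<in> gra B"
  proof (rule maximally_monotone_mem[OF B])
    fix b v assume "(b, v) \<in> gra B"
    from g[OF x(2) this] c show "0 \<le> blinfun_apply ((f - g) - v) (x - b)"
      by (simp add: x(1) blinfun.bilinear_simps)
  qed
  then have "(x, f) \<in> gra (op_sum A B)"
    using x(2) unfolding gra_def op_sum_def by (force intro: exI[of _ g] exI[of _ "f - g"])
  ultimately show ?thesis using x(1) by blast
qed

lemma strongly_representing_sum: "strongly_representing (closure sum_epi)"
  unfolding strongly_representing_def
proof (intro conjI)
  have "convex sum_epi"
  proof (rule convexI)
    fix e e' and p q :: real assume "e \<in> sum_epi" "e' \<in> sum_epi" and pq: "0 \<le> p" "0 \<le> q" "p + q = 1"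
    then obtain a u v r s a' u' v' r' s' where
      e: "e = ((a, u + v), r + s)" "((a, u), r) \<in> graph_hull A" "((a, v), s) \<in> graph_hull B"
      and e': "e' = ((a', u' + v'), r' + s')" "((a', u'), r') \<in> graph_hull A" "((a', v'), s') \<in> graph_hull B"
      unfolding sum_epi_def by blast
    have "((p *\<^sub>R a + q *\<^sub>R a', p *\<^sub>R u + q *\<^sub>R u'), p * r + q * r') \<in> graph_hull A"
      using convexD[OF convex_graph_hull e(2) e'(2) pq] by simp
    moreover have "((p *\<^sub>R a + q *\<^sub>R a', p *\<^sub>R v + q *\<^sub>R v'), p * s + q * s') \<in> graph_hull B"
      using convexD[OF convex_graph_hull e(3) e'(3) pq] by simp
    ultimately have "((p *\<^sub>R a + q *\<^sub>R a', (p *\<^sub>R u + q *\<^sub>R u') + (p *\<^sub>R v + q *\<^sub>R v')), (p * r + q * r') + (p * s + q * s')) \<in> sum_epi"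
      unfolding sum_epi_def by blast
    then show "p *\<^sub>R e + q *\<^sub>R e' \<in> sum_epi"
      by (simp add: e(1) e'(1) scaleR_add_right algebra_simps)
  qed
  then show "convex (closure sum_epi)" by (rule convex_closure)
  show "closed (closure sum_epi)" by simp
  show "closure sum_epi \<noteq> {}"
  proof -
    obtain t a b where "t > (0::real)" "a \<in> op_dom A" "b \<in> op_dom B" "0 = t *\<^sub>R (a - b)"
      using subspace_0[OF L(2)] unfolding L_def set_diff_def by auto
    then obtain u v where "(a, u) \<in> gra A" "(a, v) \<in> gra B" by (auto simp: op_dom_def gra_def)
    then have "((a, u + v), pairing (a, u) + pairing (a, v)) \<in> sum_epi"
      unfolding sum_epi_def using graph_hull_inc by blast
    then show ?thesis by auto
  qed
  show "\<forall>(z, r)\<in>closure sum_epi. pairing z \<le> r"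
  proof -
    have "closed {e :: ('a \<times> 'a dual) \<times> real. pairing (fst e) \<le> snd e}"
      unfolding pairing_def by (intro closed_Collect_le continuous_intros)
    moreover have "sum_epi \<subseteq> {e. pairing (fst e) \<le> snd e}"
      using graph_hull_pairing_le[OF A] graph_hull_pairing_le[OF B]
      by (auto simp: sum_epi_def blinfun.add_left intro!: add_mono)
    ultimately have "closure sum_epi \<subseteq> {e. pairing (fst e) \<le> snd e}" by (rule closure_minimal[rotated])
    then show ?thesis by auto
  qed
  show "\<forall>(xx :: 'a bidual) (f :: 'a dual). \<forall>\<epsilon>>0. \<exists>((a, w), r)\<in>closure sum_epi.
     blinfun_apply xx f - \<epsilon> < blinfun_apply xx w + blinfun_apply f a - r"
  proof (intro allI impI, rule ccontr)
    fix xx :: "'a bidual" and f :: "'a dual" and \<epsilon> :: real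
    assume "\<epsilon> > 0" and no: "\<not> (\<exists>((a, w), r)\<in>closure sum_epi.
      blinfun_apply xx f - \<epsilon> < blinfun_apply xx w + blinfun_apply f a - r)"
    have "blinfun_apply xx w + blinfun_apply f a - r \<le> xx f - \<epsilon>" if "((a, w), r) \<in> sum_epi" for a w r
      using no subsetD[OF closure_subset that] by fastforce
    \<comment> \<open>A bound strictly below \<open>xx f\<close> contradicts the equality in
      \<open>sum_epi_conjugate\<close>.\<close>
    then show False using sum_epi_conjugate[of xx f "xx f - \<epsilon>"] \<open>\<epsilon> > 0\<close> by simp
  qed
qed

text \<open>By the subgradient inequality, contact at \<open>(a, w)\<close> bounds the conjugate at
  the embedded \<open>a\<close> and \<open>w\<close> by \<open>w a\<close>, the equality case of
  \<open>sum_epi_conjugate\<close>.\<close>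

lemma exact_mem_sum:
  assumes "((a, w), blinfun_apply w a) \<in> closure sum_epi"
  shows "(a, w) \<in> gra (op_sum A B)"
proof -
  have "canonical_embedding a v + w y - s \<le> w a" if "((y, v), s) \<in> sum_epi" for y v s
    using strongly_representing_subgradient[OF strongly_representing_sum assms subsetD[OF closure_subset that]]
    by simp
  from sum_epi_conjugate[OF this]
  obtain x where x: "canonical_embedding a = canonical_embedding x" "(x, w) \<in> gra (op_sum A B)" by auto
  have "a = x" using x(1) by (rule canonical_embedding_inj)
  then show ?thesis using x(2) by simp
qed

text \<open>Exact points \<open>(a, w)\<close> are chosen with \<open>w\<close> close to the tilted
  target \<open>f + t *\<^sub>R e\<close>. As the tilt carries the factor \<open>t\<close> and the
  tolerance is \<open>t\<^sup>2\<close>, monotone relatedness yields \<open>e a \<ge> xx e\<close>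
  up to order \<open>t\<close>; the subgradient inequality at \<open>(a, w)\<close> then gives the
  claim up to order \<open>t\<close>.\<close>

lemma monotonically_related_bound:
  fixes xx :: "'a bidual" and f :: "'a dual"
  assumes rel: "\<And>a w. (a, w) \<in> gra (op_sum A B) \<Longrightarrow> 0 \<le> blinfun_apply (xx - canonical_embedding a) (f - w)"
    and yvs: "((y, v), s) \<in> closure sum_epi"
  shows "xx v + f y - s \<le> xx f"
proof -
  define e where "e = v - f"
  define b E S C where "b = norm xx" and "E = norm e" and "S = sqrt (b\<^sup>2 + (1 + E\<^sup>2 / 2 + E * b))"
    and "C = 2 * (1 + b\<^sup>2 / 2) + 2 * S * (b + norm y) + E * norm y + b * E"
  have pos: "0 \<le> b" "0 \<le> E" by (simp_all add: b_def E_def)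
  have "f y + xx e \<le> s + t * C" if t: "0 < t" "t \<le> 1" for t
  proof -
    obtain a w where aw: "((a, w), blinfun_apply w a) \<in> closure sum_epi"
      and small: "blinfun_apply (w - (f + t *\<^sub>R e)) a + t\<^sup>2 * (norm a)\<^sup>2 / 2
        + (norm (w - (f + t *\<^sub>R e)))\<^sup>2 / (2 * t\<^sup>2) < t\<^sup>2"
      using strongly_representing_scaled[OF strongly_representing_sum _ t(1), of "t\<^sup>2" "f + t *\<^sub>R e"] t
      by auto
    \<comment> \<open>The residual \<open>h\<close> is of order \<open>t\<close>: \<open>x\<close>
      is bounded by \<open>2 * S\<close> independently of \<open>t\<close>.\<close>
    define h where "h = w - (f + t *\<^sub>R e)"
    define K x where "K = 1 + b\<^sup>2 / 2" and "x = norm h / t"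
    have w: "w = f + t *\<^sub>R e + h" by (simp add: h_def)
    have h: "norm h = t * x" using t by (simp add: x_def)
    have xxh: "\<bar>xx h\<bar> \<le> b * (t * x)" using norm_blinfun[of xx h] by (simp add: b_def h)
    have hy: "\<bar>h y\<bar> \<le> t * x * norm y" using norm_blinfun[of h y] by (simp add: h)
    have ey: "\<bar>e y\<bar> \<le> E * norm y" using norm_blinfun[of e y] by (simp add: E_def)
    have ea: "\<bar>e a\<bar> \<le> E * norm a" using norm_blinfun[of e a] by (simp add: E_def)
    have xxe: "\<bar>xx e\<bar> \<le> b * E" using norm_blinfun[of xx e] by (simp add: E_def b_def)
    have small: "h a + t\<^sup>2 * (norm a)\<^sup>2 / 2 + x\<^sup>2 / 2 < t\<^sup>2"
      using small t unfolding h_def[symmetric] h by (simp add: power_mult_distrib)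
    have rel: "0 \<le> h a - xx h + t * (e a - xx e)"
      using rel[OF exact_mem_sum[OF aw]] unfolding w by (simp add: blinfun.bilinear_simps algebra_simps)
    have low: "h a - xx h \<le> t * K" and d: "- (t * K) \<le> e a - xx e" and x: "x \<le> 2 * S"
      using scaled_approximation_estimates[OF t pos xxh xxe ea small rel] by (simp_all add: K_def S_def)
    have "K > 0" by (simp add: K_def add_pos_nonneg)
    have sub: "f y + t * e y + h y + (1 - t) * e a - s \<le> h a"
      using strongly_representing_subgradient[OF strongly_representing_sum aw yvs]
      by (simp add: w e_def blinfun.bilinear_simps algebra_simps)
    \<comment> \<open>This replaces \<open>e a\<close> by \<open>xx e\<close>; the weight
      \<open>1 - t\<close> is the coefficient of \<open>e a\<close> in \<open>sub\<close>.\<close>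
    have "(1 - t) * (- (t * K)) \<le> (1 - t) * (e a - xx e)" using d t by (intro mult_left_mono) auto
    moreover have "(1 - t) * (t * K) \<le> t * K" using t \<open>K > 0\<close> by (intro mult_left_le_one_le) auto
    moreover have "(1 - t) * (e a - xx e) = (1 - t) * e a - xx e + t * xx e" by (simp add: algebra_simps)
    moreover have "t * xx e \<le> t * (b * E)"
      using xxe t by (intro mult_left_mono) (auto simp: abs_le_iff)
    moreover have "t * (- e y) \<le> t * (E * norm y)"
      using ey t by (intro mult_left_mono) (auto simp: abs_le_iff)
    moreover have "xx h \<le> t * (b * (2 * S))"
    proof -
      have "t * (b * x) \<le> t * (b * (2 * S))" using x t pos by (intro mult_left_mono) auto
      then show ?thesis using xxh by (simp add: abs_le_iff algebra_simps)
    qed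
    moreover have "- h y \<le> t * (2 * S * norm y)"
    proof -
      have "t * (x * norm y) \<le> t * (2 * S * norm y)" using x t by (intro mult_left_mono mult_right_mono) auto
      then show ?thesis using hy by (simp add: abs_le_iff algebra_simps)
    qed
    ultimately have "f y + xx e \<le> s + (t * K + t * K + t * (b * (2 * S)) + t * (2 * S * norm y)
        + t * (E * norm y) + t * (b * E))"
      using sub low unfolding mult_minus_right by linarith
    also have "\<dots> = s + t * C" by (simp add: C_def K_def algebra_simps)
    finally show ?thesis .
  qed
  then have "f y + xx e \<le> s" by (rule le_of_linear_perturbation)
  then show ?thesis by (simp add: e_def blinfun.diff_right)
qed

end

theorem theorem3p3:
  fixes A B :: "'a::banach operator"
  assumes "maximally_monotone A"
    and "maximally_monotone B"
    and "subspace (\<Union>t\<in>{0<..}. (\<lambda>z. t *\<^sub>R z) ` set_diff (op_dom A) (op_dom B))"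
    and "closed (\<Union>t\<in>{0<..}. (\<lambda>z. t *\<^sub>R z) ` set_diff (op_dom A) (op_dom B))"
    and "ultramaximally_monotone A"
    and "type_NI B"
  shows "ultramaximally_monotone (op_sum A B)"
proof -
  interpret ultramaximal_NI_pair A B "\<Union>t\<in>{0<..}. (\<lambda>z. t *\<^sub>R z) ` set_diff (op_dom A) (op_dom B)"
    by unfold_locales (fact assms refl)+
  show ?thesis
    unfolding ultramaximally_monotone_def
  proof (intro conjI allI impI)
    show "monotone_op (op_sum A B)"
      using assms by (intro monotone_op_sum) (auto simp: maximally_monotone_def)
    fix xx :: "'a bidual" and f :: "'a dual"
    assume "\<forall>(a, g)\<in>gra (op_sum A B). 0 \<le> blinfun_apply (xx - canonical_embedding a) (f - g)"
    then have rel: "0 \<le> blinfun_apply (xx - canonical_embedding a) (f - g)"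
      if "(a, g) \<in> gra (op_sum A B)" for a g using that by blast
    \<comment> \<open>The borderline case \<open>c = xx f\<close> of
      \<open>sum_epi_conjugate\<close>, which produces a graph point.\<close>
    have "blinfun_apply xx w + blinfun_apply f a - r \<le> xx f" if "((a, w), r) \<in> sum_epi" for a w r
      using monotonically_related_bound[OF rel subsetD[OF closure_subset that]] .
    from sum_epi_conjugate[OF this]
    show "\<exists>x. xx = canonical_embedding x \<and> (x, f) \<in> gra (op_sum A B)" by simp
  qed
qed

end
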